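(* Let $G$ be an $\mathfrak{M}_C$ group and $H\leq G$ a nilpotent subgroup. Then there exists a subgroup $D\leq G$, definable in the language of groups with parameters from $G$, such that $H\leq D$, $D$ is $N_G(H)$-normal, and $D$ is nilpotent of the same nilpotence class as $H$. Moreover, for every pair of positive integers $d$ and $n$ there exists a first-order formula $\phi_{d,n}(x,\overline{y})$ in the language of groups, with $\overline{y}$ a tuple of $dn$ variables, such that for every group $G$ of $c$-dimension $d$ and every subgroup $H\leq G$ nilpotent of class $n$, there exists a tuple $\overline{a}$ from $G$ such that $\phi_{d,n}(G,\overline{a})=\{g\in G : G\models\phi_{d,n}(g,\overline{a})\}$ is a subgroup of $G$ that is nilpotent of class $n$, contains $H$, and is $N_G(H)$-normal.
   Context: A group $G$ is $\mathfrak{M}_C$ (has the chain condition on centralizers) if there is no infinite sequence of subsets $A_n\subseteq G$ with $C_G(A_n)>C_G(A_{n+1})$ for all $n$. A group $G$ has finite centralizer dimension if there is a uniform bound on the length $n$ of chains $G=C_G(1)>C_G(A_1)>\dots>C_G(A_n)$ of centralizers of subsets $A_i\subseteq G$; the length of the longest such chain is the $c$-dimension $\dim(G)$ of $G$, and "$G$ has dimension $d$" means $\dim(G)=d$. For subgroups $A,B\leq G$, $A$ is $N_G(B)$-normal if $N_G(B)\leq N_G(A)$. Nilpotence class: the least $n\ge 0$ with $\gamma_{n+1}(G)=1$, where $\gamma_1(G)=G$, $\gamma_{k+1}(G)=[\gamma_k(G),G]$. *)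

theory Defs
  imports "HOL-Algebra.Generated_Groups" "HOL-Algebra.Group_Action"
begin

section \<open>Centralizers\<close>

definition centralizer :: "('a, 'b) monoid_scheme \<Rightarrow> 'a set \<Rightarrow> 'a set" where
  "centralizer G A = {g \<in> carrier G. \<forall>a \<in> A. g \<otimes>\<^bsub>G\<^esub> a = a \<otimes>\<^bsub>G\<^esub> g}"

definition chain_condition_centralizers :: "('a, 'b) monoid_scheme \<Rightarrow> bool" where
  "chain_condition_centralizers G \<longleftrightarrow>
     \<not> (\<exists>A :: nat \<Rightarrow> 'a set. (\<forall>n. A n \<subseteq> carrier G) \<and>
          (\<forall>n. centralizer G (A (Suc n)) \<subset> centralizer G (A n)))"

text \<open>The length of a chain is its number of strict inclusions, starting at the whole group,
  so that abelian groups have dimension 0.\<close>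

definition centralizer_chain :: "('a, 'b) monoid_scheme \<Rightarrow> nat \<Rightarrow> bool" where
  "centralizer_chain G k \<longleftrightarrow>
     (\<exists>A :: nat \<Rightarrow> 'a set. A 0 = {\<one>\<^bsub>G\<^esub>} \<and> (\<forall>i \<le> k. A i \<subseteq> carrier G) \<and>
          (\<forall>i < k. centralizer G (A (Suc i)) \<subset> centralizer G (A i)))"

definition finite_c_dimension :: "('a, 'b) monoid_scheme \<Rightarrow> bool" where
  "finite_c_dimension G \<longleftrightarrow> (\<exists>b. \<forall>k. centralizer_chain G k \<longrightarrow> k \<le> b)"

definition c_dimension :: "('a, 'b) monoid_scheme \<Rightarrow> nat" where
  "c_dimension G = Max {k. centralizer_chain G k}"

definition has_c_dimension :: "('a, 'b) monoid_scheme \<Rightarrow> nat \<Rightarrow> bool" where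
  "has_c_dimension G d \<longleftrightarrow> finite_c_dimension G \<and> c_dimension G = d"


section \<open>Nilpotence and relative normality\<close>

definition commutator_subgroup :: "('a, 'b) monoid_scheme \<Rightarrow> 'a set \<Rightarrow> 'a set \<Rightarrow> 'a set" where
  "commutator_subgroup G A B =
     generate G (\<Union>a \<in> A. \<Union>b \<in> B. {a \<otimes>\<^bsub>G\<^esub> b \<otimes>\<^bsub>G\<^esub> (inv\<^bsub>G\<^esub> a) \<otimes>\<^bsub>G\<^esub> (inv\<^bsub>G\<^esub> b)})"

text \<open>Indexing starts at 0: \<open>lower_central G k\<close> is the term usually written $\gamma_{k+1}(G)$.\<close>

primrec lower_central :: "('a, 'b) monoid_scheme \<Rightarrow> nat \<Rightarrow> 'a set" where
  "lower_central G 0 = carrier G"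
| "lower_central G (Suc k) = commutator_subgroup G (lower_central G k) (carrier G)"

definition nilpotent :: "('a, 'b) monoid_scheme \<Rightarrow> bool" where
  "nilpotent G \<longleftrightarrow> (\<exists>n. lower_central G n = {\<one>\<^bsub>G\<^esub>})"

definition nilpotence_class :: "('a, 'b) monoid_scheme \<Rightarrow> nat" where
  "nilpotence_class G = (LEAST n. lower_central G n = {\<one>\<^bsub>G\<^esub>})"

definition nilpotent_of_class :: "('a, 'b) monoid_scheme \<Rightarrow> nat \<Rightarrow> bool" where
  "nilpotent_of_class G n \<longleftrightarrow> nilpotent G \<and> nilpotence_class G = n"

text \<open>\<open>A\<close> is $N_G(B)$-normal.\<close>

definition normalizer_normal :: "('a, 'b) monoid_scheme \<Rightarrow> 'a set \<Rightarrow> 'a set \<Rightarrow> bool" where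
  "normalizer_normal G A B \<longleftrightarrow> normalizer G B \<subseteq> normalizer G A"


section \<open>First-order formulas in the language of groups\<close>

datatype gterm = GVar nat | GOne | GMult gterm gterm | GInv gterm

datatype gform = GEq gterm gterm | GNot gform | GAnd gform gform | GEx nat gform

primrec tvars :: "gterm \<Rightarrow> nat set" where
  "tvars (GVar i) = {i}"
| "tvars GOne = {}"
| "tvars (GMult s t) = tvars s \<union> tvars t"
| "tvars (GInv t) = tvars t"

primrec fvars :: "gform \<Rightarrow> nat set" where
  "fvars (GEq s t) = tvars s \<union> tvars t"
| "fvars (GNot \<phi>) = fvars \<phi>"
| "fvars (GAnd \<phi> \<psi>) = fvars \<phi> \<union> fvars \<psi>"
| "fvars (GEx i \<phi>) = fvars \<phi> - {i}"

primrec teval :: "('a, 'b) monoid_scheme \<Rightarrow> (nat \<Rightarrow> 'a) \<Rightarrow> gterm \<Rightarrow> 'a" where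
  "teval G e (GVar i) = e i"
| "teval G e GOne = \<one>\<^bsub>G\<^esub>"
| "teval G e (GMult s t) = teval G e s \<otimes>\<^bsub>G\<^esub> teval G e t"
| "teval G e (GInv t) = inv\<^bsub>G\<^esub> (teval G e t)"

primrec sat :: "('a, 'b) monoid_scheme \<Rightarrow> (nat \<Rightarrow> 'a) \<Rightarrow> gform \<Rightarrow> bool" where
  "sat G e (GEq s t) \<longleftrightarrow> teval G e s = teval G e t"
| "sat G e (GNot \<phi>) \<longleftrightarrow> \<not> sat G e \<phi>"
| "sat G e (GAnd \<phi> \<psi>) \<longleftrightarrow> sat G e \<phi> \<and> sat G e \<psi>"
| "sat G e (GEx i \<phi>) \<longleftrightarrow> (\<exists>a \<in> carrier G. sat G (e(i := a)) \<phi>)"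

text \<open>In a formula $\phi(x, y_1, \dots, y_m)$ the variable $x$ is \<open>GVar 0\<close> and $y_i$ is
  \<open>GVar i\<close>. The value \<open>\<one>\<close> at larger indices is irrelevant, since \<open>formula_in m\<close>
  bounds the free variables.\<close>

definition formula_in :: "nat \<Rightarrow> gform \<Rightarrow> bool" where
  "formula_in m \<phi> \<longleftrightarrow> fvars \<phi> \<subseteq> {0..m}"

definition assignment :: "('a, 'b) monoid_scheme \<Rightarrow> 'a list \<Rightarrow> nat \<Rightarrow> 'a" where
  "assignment G xs i = (if i < length xs then xs ! i else \<one>\<^bsub>G\<^esub>)"

definition solution_set :: "('a, 'b) monoid_scheme \<Rightarrow> gform \<Rightarrow> 'a list \<Rightarrow> 'a set" where
  "solution_set G \<phi> as = {g \<in> carrier G. sat G (assignment G (g # as)) \<phi>}"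

definition definable :: "('a, 'b) monoid_scheme \<Rightarrow> 'a set \<Rightarrow> bool" where
  "definable G D \<longleftrightarrow>
     (\<exists>\<phi> as. formula_in (length as) \<phi> \<and> set as \<subseteq> carrier G \<and> D = solution_set G \<phi> as)"


section \<open>Uniform definability of envelopes\<close>

text \<open>\<open>envelope_formula TYPE('a) d n \<phi>\<close>: the formula \<open>\<phi>(x, y)\<close>, with \<open>d * n\<close> parameter
  variables, defines nilpotent envelopes in all groups of c-dimension \<open>d\<close> whose elements are
  of type \<open>'a\<close>, for all of their subgroups that are nilpotent of class \<open>n\<close>.

  A formula that serves all groups must not depend on the type \<open>'a\<close>, but in HOL an
  existential quantifier over formulas is always inside the implicit quantifier over types:
  \<open>\<exists>\<phi>. envelope_formula TYPE('a) d n \<phi>\<close> would allow a different \<open>\<phi>\<close> for each \<open>'a\<close>.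
  Independence of the type is expressed by two statements: some \<open>\<phi>\<close> satisfies
  \<open>envelope_formula TYPE(nat) d n \<phi>\<close>, in which no type variable occurs, and every such \<open>\<phi>\<close>
  satisfies \<open>envelope_formula TYPE('a) d n \<phi>\<close> for arbitrary \<open>'a\<close>.\<close>

definition envelope_formula :: "'a itself \<Rightarrow> nat \<Rightarrow> nat \<Rightarrow> gform \<Rightarrow> bool" where
  "envelope_formula (T :: 'a itself) d n \<phi> \<longleftrightarrow>
     formula_in (d * n) \<phi> \<and>
     (\<forall>(G :: 'a monoid) H.
        group G \<and> has_c_dimension G d \<and>
        subgroup H G \<and> nilpotent_of_class (G\<lparr>carrier := H\<rparr>) n \<longrightarrow>
        (\<exists>as. length as = d * n \<and> set as \<subseteq> carrier G \<and>
           subgroup (solution_set G \<phi> as) G \<and>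
           nilpotent_of_class (G\<lparr>carrier := solution_set G \<phi> as\<rparr>) n \<and>
           H \<subseteq> solution_set G \<phi> as \<and>
           normalizer_normal G (solution_set G \<phi> as) H))"

end

theory Submission
  imports Defs "HOL-Library.Countable_Set"
begin

text \<open>Let $E_0 = G$ and let $E_{k+1}$ consist of the $g \in E_k$ with $[x, g] \in Z_k(E_k)$ for all
  $x \in E_k$ such that $[x, H] \subseteq Z_k(E_k)$. The upper central series stabilizes along this
  sequence and satisfies $Z_{i+1}(E_k) = \{x \in E_k : [x, H] \subseteq Z_i(E_k)\}$ for $i < k$. Hence
  $Z_i(H) \subseteq Z_i(E_k)$ for $i \le k$, and if $H$ has class $n$ then $D = Z_n(E_n)$ contains $H$, has
  class $n$ and is normalized by $N_G(H)$.

  For definability it suffices to replace $H$ in the definition of $E_{k+1}$ by finitely many of its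
  elements. Let $A \subseteq H$ be the finite set already used for $E_1, \dots, E_k$. If
  $[x, A] \subseteq Z_k(E_k)$ and $h \in H$, then $[x, h] \in Z_k(E_k)$ holds iff $x$ commutes with all
  $k$-fold iterated commutators of $h$ with elements of $A$. By the chain condition the centralizer of
  all these commutators, $h$ ranging over $H$, is the centralizer of finitely many of them, and of at
  most $d$ of them if $G$ has dimension $d$.

  That a formula which works for groups on the natural numbers works for all groups is a
  Loewenheim--Skolem argument: a counterexample has a countable one inside it.\<close>

section \<open>Commutators modulo the upper central series\<close>

text \<open>The chain condition concerns centralizers in $G$ and need not pass to quotients, so a
  finite test set modulo $Z_k = Z_k(E_k)$ cannot be obtained in $E_k / Z_k$. Instead, depth in the
  central series is traded for commutators: $[x, h]$ lies in $Z_k$ iff all $[[x, h], a]$ with $a$ in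
  $A$ lie in $Z_{k-1}$, since $A$ already detects the lower centres; and modulo $Z_{k-1}$ this
  amounts to the same for $[x, [h, a]]$, because the error term $[x, a]$ lies in $Z_k$. After $k$
  rounds the modulus is trivial and only centralizers in $G$ are left. In later rounds the modulus
  drops while $[x, a]$ is still only known to lie in $Z_k$; this is made up for by the growing
  weight of the commutator that has replaced $h$, which commutes with $Z_k$ modulo ever lower terms.
  The definition of $E_{k+1}$ is made for one purpose: it forces the description of
  $Z_{k+1}(E_{k+1})$ through $H$, while the lower centres keep theirs because they do not change.
  Each of the $n$ levels contributes at most $d$ parameters, whence $dn$.\<close>

definition comm :: "('a, 'b) monoid_scheme \<Rightarrow> 'a \<Rightarrow> 'a \<Rightarrow> 'a" where
  "comm G x y = x \<otimes>\<^bsub>G\<^esub> y \<otimes>\<^bsub>G\<^esub> inv\<^bsub>G\<^esub> x \<otimes>\<^bsub>G\<^esub> inv\<^bsub>G\<^esub> y"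

text \<open>The factor that conjugation puts behind \<open>a\<close>: $t^{-1} a t = a s$ with $s$ =
  \<open>twisted_comm G t a\<close>. With this convention the exchange in
  \<open>commute_comm_iff\<close> needs no extra conjugations.\<close>

definition twisted_comm :: "('a, 'b) monoid_scheme \<Rightarrow> 'a \<Rightarrow> 'a \<Rightarrow> 'a" where
  "twisted_comm G t a = inv\<^bsub>G\<^esub> a \<otimes>\<^bsub>G\<^esub> inv\<^bsub>G\<^esub> t \<otimes>\<^bsub>G\<^esub> a \<otimes>\<^bsub>G\<^esub> t"

text \<open>Formed relative to a subset of \<open>G\<close>, so that the central series of different
  envelopes are sets in one group and can be compared directly.\<close>

primrec upper_central :: "('a, 'b) monoid_scheme \<Rightarrow> 'a set \<Rightarrow> nat \<Rightarrow> 'a set" where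
  "upper_central G E 0 = {\<one>\<^bsub>G\<^esub>}"
| "upper_central G E (Suc i) = {x \<in> E. \<forall>y \<in> E. comm G x y \<in> upper_central G E i}"

context group
begin

section \<open>Commutator identities in a group\<close>

lemma inv_cancel_left:
  "x \<in> carrier G \<Longrightarrow> y \<in> carrier G \<Longrightarrow> inv x \<otimes> (x \<otimes> y) = y"
  "x \<in> carrier G \<Longrightarrow> y \<in> carrier G \<Longrightarrow> x \<otimes> (inv x \<otimes> y) = y"
  by (simp_all add: m_assoc [symmetric])

lemmas word_simps = m_assoc inv_mult_group inv_cancel_left

lemma comm_closed [simp, intro]:
  "x \<in> carrier G \<Longrightarrow> y \<in> carrier G \<Longrightarrow> comm G x y \<in> carrier G"
  by (simp add: comm_def)

lemma twisted_comm_closed [simp, intro]: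
  "x \<in> carrier G \<Longrightarrow> y \<in> carrier G \<Longrightarrow> twisted_comm G x y \<in> carrier G"
  by (simp add: twisted_comm_def)

lemma comm_one [simp]:
  "x \<in> carrier G \<Longrightarrow> comm G x \<one> = \<one>" "x \<in> carrier G \<Longrightarrow> comm G \<one> x = \<one>"
  by (simp_all add: comm_def)

lemma comm_swap:
  "x \<in> carrier G \<Longrightarrow> y \<in> carrier G \<Longrightarrow> comm G y x = inv (comm G x y)"
  by (simp add: comm_def word_simps)

lemma comm_mult_left:
  "x \<in> carrier G \<Longrightarrow> x' \<in> carrier G \<Longrightarrow> y \<in> carrier G \<Longrightarrow>
    comm G (x \<otimes> x') y = x \<otimes> comm G x' y \<otimes> inv x \<otimes> comm G x y"
  by (simp add: comm_def word_simps)

lemma comm_inv_left: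
  "x \<in> carrier G \<Longrightarrow> y \<in> carrier G \<Longrightarrow>
    comm G (inv x) y = inv x \<otimes> inv (comm G x y) \<otimes> x"
  by (simp add: comm_def word_simps)

lemma comm_conj_left:
  "g \<in> carrier G \<Longrightarrow> x \<in> carrier G \<Longrightarrow> y \<in> carrier G \<Longrightarrow>
    comm G (g \<otimes> x \<otimes> inv g) y = g \<otimes> comm G x (inv g \<otimes> y \<otimes> g) \<otimes> inv g"
  by (simp add: comm_def word_simps)

lemma comm_eq_one_iff:
  assumes "x \<in> carrier G" "y \<in> carrier G"
  shows "comm G x y = \<one> \<longleftrightarrow> x \<otimes> y = y \<otimes> x"
proof
  assume "comm G x y = \<one>"
  then have "comm G x y \<otimes> (y \<otimes> x) = y \<otimes> x" using assms by simp
  then show "x \<otimes> y = y \<otimes> x" using assms by (simp add: comm_def word_simps)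
next
  assume "x \<otimes> y = y \<otimes> x"
  then show "comm G x y = \<one>" using assms by (simp add: comm_def word_simps)
qed

section \<open>The upper central series of a subgroup\<close>

lemma comm_in_subgroup:
  "subgroup E G \<Longrightarrow> x \<in> E \<Longrightarrow> y \<in> E \<Longrightarrow> comm G x y \<in> E"
  by (simp add: comm_def subgroup.m_closed subgroup.m_inv_closed)

lemma twisted_comm_in_subgroup:
  "subgroup E G \<Longrightarrow> x \<in> E \<Longrightarrow> y \<in> E \<Longrightarrow> twisted_comm G x y \<in> E"
  by (simp add: twisted_comm_def subgroup.m_closed subgroup.m_inv_closed)

text \<open>The properties go through one induction: closure of the next term under products and
  inverses uses that the present one is invariant under conjugation by \<open>E\<close>, as
  $[xx', y] = x [x', y] x^{-1} [x, y]$.\<close>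

lemma upper_central_props:
  assumes "subgroup E G"
  shows "subgroup (upper_central G E i) G \<and> upper_central G E i \<subseteq> E \<and>
    (\<forall>g \<in> E. \<forall>x \<in> upper_central G E i. g \<otimes> x \<otimes> inv g \<in> upper_central G E i)"
proof (induction i)
  case 0
  show ?case using assms
    by (auto simp: subgroup.one_closed subgroup.mem_carrier [OF assms] intro: triv_subgroup)
next
  case (Suc i)
  let ?Z = "upper_central G E i"
  interpret E: subgroup E G by fact
  interpret Z: subgroup ?Z G using Suc by blast
  have ZE: "?Z \<subseteq> E" and norm: "\<And>g x. g \<in> E \<Longrightarrow> x \<in> ?Z \<Longrightarrow> g \<otimes> x \<otimes> inv g \<in> ?Z"
    using Suc by blast+
  have conj: "g \<otimes> x \<otimes> inv g \<in> upper_central G E (Suc i)"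
    if "g \<in> E" "x \<in> upper_central G E (Suc i)" for g x
    using that norm by (auto simp: comm_conj_left)
  have "subgroup (upper_central G E (Suc i)) G"
  proof
    show "upper_central G E (Suc i) \<subseteq> carrier G" by auto
    show "\<one> \<in> upper_central G E (Suc i)" by auto
    show "x \<otimes> y \<in> upper_central G E (Suc i)"
      if "x \<in> upper_central G E (Suc i)" "y \<in> upper_central G E (Suc i)" for x y
      using that norm by (auto simp: comm_mult_left)
    show "inv x \<in> upper_central G E (Suc i)" if "x \<in> upper_central G E (Suc i)" for x
    proof -
      have "inv x \<otimes> inv (comm G x y) \<otimes> x \<in> ?Z" if "y \<in> E" for y
        using norm [of "inv x" "inv (comm G x y)"] \<open>x \<in> _\<close> that by auto
      then show ?thesis using that by (auto simp: comm_inv_left)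
    qed
  qed
  then show ?case using conj by auto
qed

lemma upper_central_subgroup: "subgroup E G \<Longrightarrow> subgroup (upper_central G E i) G"
  and upper_central_subset: "subgroup E G \<Longrightarrow> upper_central G E i \<subseteq> E"
  and upper_central_conj: "subgroup E G \<Longrightarrow> g \<in> E \<Longrightarrow> x \<in> upper_central G E i \<Longrightarrow>
    g \<otimes> x \<otimes> inv g \<in> upper_central G E i"
  by (simp_all add: upper_central_props)

lemma comm_in_normalized:
  assumes E: "subgroup E G" and N: "subgroup N G" "N \<subseteq> E"
    and norm: "\<And>g x. g \<in> E \<Longrightarrow> x \<in> N \<Longrightarrow> g \<otimes> x \<otimes> inv g \<in> N"
    and "x \<in> N" "y \<in> E"
  shows "comm G x y \<in> N"
proof -
  have c: "x \<in> carrier G" "y \<in> carrier G"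
    using E N(1) \<open>x \<in> N\<close> \<open>y \<in> E\<close> by (auto dest: subgroup.mem_carrier)
  have "x \<otimes> (y \<otimes> inv x \<otimes> inv y) \<in> N"
    using \<open>x \<in> N\<close> \<open>y \<in> E\<close>
    by (intro subgroup.m_closed [OF N(1)] norm subgroup.m_inv_closed [OF N(1)])
  then show ?thesis using c by (simp add: comm_def word_simps)
qed

lemma comm_swap_in:
  "subgroup N G \<Longrightarrow> x \<in> carrier G \<Longrightarrow> y \<in> carrier G \<Longrightarrow> comm G x y \<in> N \<longleftrightarrow> comm G y x \<in> N"
  by (metis comm_swap subgroup.m_inv_closed)

lemma upper_central_Suc_mono:
  assumes E: "subgroup E G"
  shows "upper_central G E i \<subseteq> upper_central G E (Suc i)"
proof
  fix x assume x: "x \<in> upper_central G E i"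
  then have "comm G x y \<in> upper_central G E i" if "y \<in> E" for y
    using comm_in_normalized [OF E upper_central_subgroup [OF E] upper_central_subset [OF E]]
      upper_central_conj [OF E] that by blast
  then show "x \<in> upper_central G E (Suc i)" using x upper_central_subset [OF E] by auto
qed

lemma upper_central_mono:
  assumes E: "subgroup E G" and "i \<le> j"
  shows "upper_central G E i \<subseteq> upper_central G E j"
  by (rule lift_Suc_mono_le [of "upper_central G E", OF upper_central_Suc_mono [OF E] \<open>i \<le> j\<close>])

section \<open>Passing to quotients by terms of the upper central series\<close>

lemma quotient_hom:
  assumes E: "subgroup E G" and N: "subgroup N G" "N \<subseteq> E"
    and norm: "\<And>g x. g \<in> E \<Longrightarrow> x \<in> N \<Longrightarrow> g \<otimes> x \<otimes> inv g \<in> N"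
  obtains Q :: "'a set monoid" and \<pi> where "group Q"
    "\<And>x. x \<in> E \<Longrightarrow> \<pi> x \<in> carrier Q"
    "\<And>x y. x \<in> E \<Longrightarrow> y \<in> E \<Longrightarrow> \<pi> (x \<otimes> y) = \<pi> x \<otimes>\<^bsub>Q\<^esub> \<pi> y"
    "\<And>x. x \<in> E \<Longrightarrow> \<pi> (inv x) = inv\<^bsub>Q\<^esub> \<pi> x"
    "\<And>x. x \<in> E \<Longrightarrow> x \<in> N \<longleftrightarrow> \<pi> x = \<one>\<^bsub>Q\<^esub>"
proof -
  let ?E = "G\<lparr>carrier := E\<rparr>"
  interpret EG: group ?E using E by (rule subgroup_imp_group)
  have sub: "subgroup N ?E" using subgroup_incl [OF N(1) E N(2)] .
  have "normal N ?E"
    unfolding EG.normal_inv_iff using sub norm E by (simp add: m_inv_consistent)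
  then interpret Nn: normal N ?E .
  show thesis
  proof (rule that [of "?E Mod N" "\<lambda>x. N #>\<^bsub>?E\<^esub> x"])
    show gQ: "group (?E Mod N)" by (rule Nn.factorgroup_is_group)
    show c: "N #>\<^bsub>?E\<^esub> x \<in> carrier (?E Mod N)" if "x \<in> E" for x
      using that by (auto simp: FactGroup_def RCOSETS_def)
    show m: "N #>\<^bsub>?E\<^esub> (x \<otimes> y) = (N #>\<^bsub>?E\<^esub> x) \<otimes>\<^bsub>?E Mod N\<^esub> (N #>\<^bsub>?E\<^esub> y)"
      if "x \<in> E" "y \<in> E" for x y
      using Nn.rcos_sum [of x y] that by (simp add: FactGroup_def)
    show "N #>\<^bsub>?E\<^esub> inv x = inv\<^bsub>?E Mod N\<^esub> (N #>\<^bsub>?E\<^esub> x)" if "x \<in> E" for x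
      using Nn.inv_FactGroup [OF c [OF that]] Nn.rcos_inv [of x] that E
      by (simp add: m_inv_consistent)
    show "x \<in> N \<longleftrightarrow> N #>\<^bsub>?E\<^esub> x = \<one>\<^bsub>?E Mod N\<^esub>" if "x \<in> E" for x
      using that sub EG.coset_join1 [of N x] EG.coset_join2 [of x N]
      by (auto simp: FactGroup_def N subgroup.subset)
  qed
qed

text \<open>This replaces the Hall--Witt identity: modulo elements commuting with \<open>t\<close>, moving \<open>a\<close>
  past \<open>[x, t]\<close> amounts to moving \<open>x\<close> past a commutator of \<open>t\<close> and \<open>a\<close>.\<close>

lemma commute_comm_iff:
  assumes c: "a \<in> carrier G" "x \<in> carrier G" "t \<in> carrier G"
    and zt: "twisted_comm G x a \<otimes> t = t \<otimes> twisted_comm G x a"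
    and zc: "twisted_comm G x a \<otimes> twisted_comm G t a = twisted_comm G t a \<otimes> twisted_comm G x a"
  shows "comm G x t \<otimes> a = a \<otimes> comm G x t \<longleftrightarrow> x \<otimes> twisted_comm G t a = twisted_comm G t a \<otimes> x"
proof -
  define z where "z = twisted_comm G x a"
  define s where "s = twisted_comm G t a"
  have zC: "z \<in> carrier G" and sC: "s \<in> carrier G" using c by (auto simp: z_def s_def)
  have xa: "inv x \<otimes> a \<otimes> x = a \<otimes> z" using c by (simp add: z_def twisted_comm_def word_simps)
  have ta: "inv t \<otimes> a \<otimes> t = a \<otimes> s" using c by (simp add: s_def twisted_comm_def word_simps)
  \<comment> \<open>Multiplying by $x^{-1}$ on the left and $t x t^{-1}$ on the right turns the
    left-hand condition into an equality of two conjugates of \<open>a\<close>; expanding these by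
    \<open>xa\<close> and \<open>ta\<close> lets \<open>a\<close> and \<open>z\<close>
    cancel.\<close>
  have "comm G x t \<otimes> a = a \<otimes> comm G x t \<longleftrightarrow>
      t \<otimes> (inv x \<otimes> (inv t \<otimes> a \<otimes> t) \<otimes> x) \<otimes> inv t = inv x \<otimes> a \<otimes> x"
  proof -
    have "comm G x t \<otimes> a = a \<otimes> comm G x t \<longleftrightarrow>
        inv x \<otimes> (comm G x t \<otimes> a) \<otimes> (t \<otimes> x \<otimes> inv t) = inv x \<otimes> (a \<otimes> comm G x t) \<otimes> (t \<otimes> x \<otimes> inv t)"
      using c by simp
    also have "inv x \<otimes> (comm G x t \<otimes> a) \<otimes> (t \<otimes> x \<otimes> inv t) =
        t \<otimes> (inv x \<otimes> (inv t \<otimes> a \<otimes> t) \<otimes> x) \<otimes> inv t"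
      using c by (simp add: comm_def word_simps)
    also have "inv x \<otimes> (a \<otimes> comm G x t) \<otimes> (t \<otimes> x \<otimes> inv t) = inv x \<otimes> a \<otimes> x"
      using c by (simp add: comm_def word_simps)
    finally show ?thesis .
  qed
  also have "\<dots> \<longleftrightarrow> t \<otimes> (inv x \<otimes> (a \<otimes> s) \<otimes> x) \<otimes> inv t = a \<otimes> z" by (simp only: ta xa)
  also have "inv x \<otimes> (a \<otimes> s) \<otimes> x = a \<otimes> z \<otimes> (inv x \<otimes> s \<otimes> x)"
    using c sC by (simp add: xa [symmetric] word_simps)
  also have "t \<otimes> (a \<otimes> z \<otimes> (inv x \<otimes> s \<otimes> x)) \<otimes> inv t = a \<otimes> z \<longleftrightarrow>
      a \<otimes> z \<otimes> (inv x \<otimes> s \<otimes> x) = inv t \<otimes> (a \<otimes> z) \<otimes> t"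
  proof -
    have "t \<otimes> (a \<otimes> z \<otimes> (inv x \<otimes> s \<otimes> x)) \<otimes> inv t = a \<otimes> z \<longleftrightarrow>
      inv t \<otimes> (t \<otimes> (a \<otimes> z \<otimes> (inv x \<otimes> s \<otimes> x)) \<otimes> inv t) \<otimes> t = inv t \<otimes> (a \<otimes> z) \<otimes> t"
      using c sC zC by simp
    then show ?thesis using c sC zC by (simp add: word_simps)
  qed
  also have "inv t \<otimes> (a \<otimes> z) \<otimes> t = a \<otimes> z \<otimes> s"
  proof -
    have "inv t \<otimes> (a \<otimes> z) \<otimes> t = inv t \<otimes> a \<otimes> (z \<otimes> t)" using c zC by (simp add: word_simps)
    also have "\<dots> = inv t \<otimes> a \<otimes> t \<otimes> z" using c zC zt by (simp add: z_def [symmetric] word_simps)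
    also have "\<dots> = a \<otimes> z \<otimes> s" using c zC sC zc unfolding ta by (simp add: z_def [symmetric] s_def [symmetric] word_simps)
    finally show ?thesis .
  qed
  also have "a \<otimes> z \<otimes> (inv x \<otimes> s \<otimes> x) = a \<otimes> z \<otimes> s \<longleftrightarrow> inv x \<otimes> s \<otimes> x = s"
    using c zC sC by simp
  also have "\<dots> \<longleftrightarrow> x \<otimes> (inv x \<otimes> s \<otimes> x) = x \<otimes> s" using c sC by simp
  also have "\<dots> \<longleftrightarrow> x \<otimes> s = s \<otimes> x" using c sC by (auto simp: word_simps)
  finally show ?thesis by (simp add: s_def)
qed

text \<open>Conjugation by \<open>z\<close> turns $s = a^{-1} t^{-1} a t$ into the same word in $a
  w$ and $t v$, where $w$ and $v$ are the twisted commutators of $z^{-1}$ with \<open>a\<close> and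
  \<open>t\<close>. As $v$ commutes with $a$, $t$, $w$, and $w$ with $t$ and $s$, both factors drop
  out.\<close>

lemma commute_twisted_comm:
  assumes c: "a \<in> carrier G" "t \<in> carrier G" "z \<in> carrier G"
    and va: "twisted_comm G (inv z) t \<otimes> a = a \<otimes> twisted_comm G (inv z) t"
    and vt: "twisted_comm G (inv z) t \<otimes> t = t \<otimes> twisted_comm G (inv z) t"
    and vw: "twisted_comm G (inv z) t \<otimes> twisted_comm G (inv z) a =
      twisted_comm G (inv z) a \<otimes> twisted_comm G (inv z) t"
    and wt: "twisted_comm G (inv z) a \<otimes> t = t \<otimes> twisted_comm G (inv z) a"
    and ws: "twisted_comm G (inv z) a \<otimes> twisted_comm G t a = twisted_comm G t a \<otimes> twisted_comm G (inv z) a"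
  shows "z \<otimes> twisted_comm G t a = twisted_comm G t a \<otimes> z"
proof -
  define w where "w = twisted_comm G (inv z) a"
  define v where "v = twisted_comm G (inv z) t"
  define s where "s = twisted_comm G t a"
  have C: "w \<in> carrier G" "v \<in> carrier G" "s \<in> carrier G" using c by (auto simp: w_def v_def s_def)
  have za: "z \<otimes> a \<otimes> inv z = a \<otimes> w" using c by (simp add: w_def twisted_comm_def word_simps)
  have zt: "z \<otimes> t \<otimes> inv z = t \<otimes> v" using c by (simp add: v_def twisted_comm_def word_simps)
  note va = va [folded v_def] and vt = vt [folded v_def] and vw = vw [folded v_def w_def]
    and wt = wt [folded w_def] and ws = ws [folded w_def s_def]
  have "z \<otimes> s \<otimes> inv z = inv (z \<otimes> a \<otimes> inv z) \<otimes> (inv (z \<otimes> t \<otimes> inv z) \<otimes> ((z \<otimes> a \<otimes> inv z) \<otimes> (z \<otimes> t \<otimes> inv z)))"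
    using c by (simp add: s_def twisted_comm_def word_simps)
  also have "\<dots> = inv (a \<otimes> w) \<otimes> (inv (t \<otimes> v) \<otimes> ((a \<otimes> w) \<otimes> (t \<otimes> v)))" by (simp only: za zt)
  also have "(a \<otimes> w) \<otimes> (t \<otimes> v) = (v \<otimes> a) \<otimes> (w \<otimes> t)"
  proof -
    have "(a \<otimes> w) \<otimes> (t \<otimes> v) = a \<otimes> (w \<otimes> v) \<otimes> t" unfolding vt [symmetric] using c C by (simp add: m_assoc)
    also have "\<dots> = (a \<otimes> v) \<otimes> (w \<otimes> t)" unfolding vw [symmetric] using c C by (simp add: m_assoc)
    finally show ?thesis by (simp only: va)
  qed
  also have "inv (t \<otimes> v) \<otimes> (v \<otimes> a \<otimes> (w \<otimes> t)) = inv t \<otimes> a \<otimes> (w \<otimes> t)"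
    unfolding vt [symmetric] using c C by (simp add: word_simps)
  also have "inv (a \<otimes> w) \<otimes> (inv t \<otimes> a \<otimes> (w \<otimes> t)) = inv w \<otimes> (s \<otimes> w)"
    unfolding wt using c C by (simp add: s_def twisted_comm_def word_simps)
  also have "\<dots> = s" unfolding ws [symmetric] using c C by (simp add: word_simps)
  finally have "z \<otimes> s \<otimes> inv z \<otimes> z = s \<otimes> z" by simp
  then show ?thesis using c C by (simp add: s_def word_simps)
qed

section \<open>Commutator weight and descent in the upper central series\<close>

lemma twisted_comm_conv_comm:
  "x \<in> carrier G \<Longrightarrow> a \<in> carrier G \<Longrightarrow> twisted_comm G x a = comm G (inv a) (inv x)"
  by (simp add: comm_def twisted_comm_def word_simps)

text \<open>\<open>central_commuting E j\<close> contains the term usually written $\gamma_j(E)$. The commutator property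
  itself is the definition, so that no three subgroup lemma is needed.\<close>

definition central_commuting :: "'a set \<Rightarrow> nat \<Rightarrow> 'a set" where
  "central_commuting E j =
     {t \<in> E. \<forall>m. \<forall>z \<in> upper_central G E m. comm G z t \<in> upper_central G E (m - j)}"

lemma central_commuting_Suc_0:
  assumes "subgroup E G" "t \<in> E"
  shows "t \<in> central_commuting E (Suc 0)"
proof -
  have "comm G z t \<in> upper_central G E (m - Suc 0)" if "z \<in> upper_central G E m" for m z
    using that assms by (cases m) (auto dest: subgroup.mem_carrier)
  then show ?thesis using assms by (simp add: central_commuting_def)
qed

text \<open>Lets exact identities of groups be applied modulo $Z_i(E)$: commutators in $Z_i(E)$
  become commuting images, and the map respects both kinds of commutator.\<close>

lemma upper_central_quotient:
  assumes E: "subgroup E G"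
  obtains Q :: "'a set monoid" and \<pi> where "group Q"
    "\<And>x. x \<in> E \<Longrightarrow> \<pi> x \<in> carrier Q"
    "\<And>x. x \<in> E \<Longrightarrow> \<pi> (inv x) = inv\<^bsub>Q\<^esub> \<pi> x"
    "\<And>x y. x \<in> E \<Longrightarrow> y \<in> E \<Longrightarrow> \<pi> (comm G x y) = comm Q (\<pi> x) (\<pi> y)"
    "\<And>x y. x \<in> E \<Longrightarrow> y \<in> E \<Longrightarrow> \<pi> (twisted_comm G x y) = twisted_comm Q (\<pi> x) (\<pi> y)"
    "\<And>x y. x \<in> E \<Longrightarrow> y \<in> E \<Longrightarrow>
      comm G x y \<in> upper_central G E i \<longleftrightarrow> \<pi> x \<otimes>\<^bsub>Q\<^esub> \<pi> y = \<pi> y \<otimes>\<^bsub>Q\<^esub> \<pi> x"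
proof (rule quotient_hom [OF E upper_central_subgroup [OF E] upper_central_subset [OF E]
    upper_central_conj [OF E], of i])
  fix Q :: "'a set monoid" and \<pi>
  assume Q: "group Q"
    and c: "\<And>x. x \<in> E \<Longrightarrow> \<pi> x \<in> carrier Q"
    and m: "\<And>x y. x \<in> E \<Longrightarrow> y \<in> E \<Longrightarrow> \<pi> (x \<otimes> y) = \<pi> x \<otimes>\<^bsub>Q\<^esub> \<pi> y"
    and i: "\<And>x. x \<in> E \<Longrightarrow> \<pi> (inv x) = inv\<^bsub>Q\<^esub> \<pi> x"
    and k: "\<And>x. x \<in> E \<Longrightarrow> x \<in> upper_central G E i \<longleftrightarrow> \<pi> x = \<one>\<^bsub>Q\<^esub>"
  note cl = subgroup.m_closed [OF E] subgroup.m_inv_closed [OF E]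
  have cm: "\<pi> (comm G x y) = comm Q (\<pi> x) (\<pi> y)" if "x \<in> E" "y \<in> E" for x y
    using that by (simp add: comm_def m i cl)
  have tw: "\<pi> (twisted_comm G x y) = twisted_comm Q (\<pi> x) (\<pi> y)" if "x \<in> E" "y \<in> E" for x y
    using that by (simp add: twisted_comm_def m i cl)
  show thesis
    using that [OF Q c i cm tw] k cm comm_in_subgroup [OF E] c group.comm_eq_one_iff [OF Q] by simp
qed auto

text \<open>Commutators with \<open>E\<close> raise the weight by one. For $z$ in $Z_{m+1}(E)$, work
  modulo $Z_{m-j}(E)$: there $v$, a commutator of $z$ and $t$, is central; $w$, a commutator of $z$
  and $a$, lies in $Z_m(E)$, so it commutes with $t$ by the weight of $t$ and with the new
  commutator by induction on $m$. Then \<open>commute_twisted_comm\<close> applies.\<close>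

lemma twisted_comm_central_commuting:
  assumes E: "subgroup E G" and t: "t \<in> central_commuting E j" and a: "a \<in> E"
  shows "twisted_comm G t a \<in> central_commuting E (Suc j)"
proof -
  have tE: "t \<in> E"
    and tc: "\<And>m z. z \<in> upper_central G E m \<Longrightarrow> comm G z t \<in> upper_central G E (m - j)"
    using t by (auto simp: central_commuting_def)
  have sE: "twisted_comm G t a \<in> E" using E tE a by (simp add: twisted_comm_in_subgroup)
  note mem = subgroup.mem_carrier [OF E]
  have "comm G z (twisted_comm G t a) \<in> upper_central G E (m - Suc j)"
    if "z \<in> upper_central G E m" for m z
    using that
  proof (induction m arbitrary: z)
    case 0
    then show ?case using sE mem by simp
  next
    case (Suc m)
    let ?N = "upper_central G E (Suc m - Suc j)"
    have zE: "z \<in> E" using Suc.prems by simp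
    have izZ: "inv z \<in> upper_central G E (Suc m)"
      using subgroup.m_inv_closed [OF upper_central_subgroup [OF E] Suc.prems] .
    have izE: "inv z \<in> E" using izZ by simp
    define w where "w = twisted_comm G (inv z) a"
    define v where "v = twisted_comm G (inv z) t"
    have v_eq: "v = comm G (inv t) z" and w_eq: "w = comm G (inv a) z"
      using zE tE a mem by (simp_all add: v_def w_def twisted_comm_conv_comm)
    have wE: "w \<in> E" and vE: "v \<in> E"
      using izE a tE E by (simp_all add: w_def v_def twisted_comm_in_subgroup)
    have wZ: "w \<in> upper_central G E m"
    proof -
      have "comm G z (inv a) \<in> upper_central G E m"
        using Suc.prems subgroup.m_inv_closed [OF E a] by simp
      then show ?thesis unfolding w_eq
        using comm_swap_in [OF upper_central_subgroup [OF E]] mem zE a by simp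
    qed
    have vZ: "v \<in> upper_central G E (Suc m - j)"
    proof -
      have "comm G z t \<in> upper_central G E (Suc m - j)" using tc Suc.prems by blast
      then have "inv t \<otimes> comm G z t \<otimes> inv (inv t) \<in> upper_central G E (Suc m - j)"
        using upper_central_conj [OF E] subgroup.m_inv_closed [OF E tE] by blast
      also have "inv t \<otimes> comm G z t \<otimes> inv (inv t) = v"
        using mem zE tE by (simp add: v_eq comm_def word_simps)
      finally show ?thesis .
    qed
    \<comment> \<open>Because subtraction is truncated, the index of the centre containing
      \<open>v\<close> may be 0; then \<open>v\<close> is trivial and there is no layer to
      descend.\<close>
    have vN: "comm G v y \<in> ?N" if "y \<in> E" for y
    proof (cases "Suc m - j")
      case 0
      then show ?thesis using vZ that mem by simp
    next
      case (Suc l)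
      then have "Suc m - Suc j = l" by simp
      then show ?thesis using vZ that Suc by simp
    qed
    have wt: "comm G w t \<in> ?N" using tc [OF wZ] by simp
    have "comm G w (twisted_comm G t a) \<in> upper_central G E (m - Suc j)" using Suc.IH wZ by blast
    then have ws: "comm G w (twisted_comm G t a) \<in> ?N"
      using upper_central_mono [OF E, of "m - Suc j" "Suc m - Suc j"] diff_le_mono [of m "Suc m" "Suc j"] by auto
    show ?case
    proof (rule upper_central_quotient [OF E, of "Suc m - Suc j"])
      fix Q :: "'a set monoid" and \<pi>
      assume Q: "group Q"
        and c: "\<And>x. x \<in> E \<Longrightarrow> \<pi> x \<in> carrier Q"
        and i: "\<And>x. x \<in> E \<Longrightarrow> \<pi> (inv x) = inv\<^bsub>Q\<^esub> \<pi> x"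
        and tw: "\<And>x y. x \<in> E \<Longrightarrow> y \<in> E \<Longrightarrow> \<pi> (twisted_comm G x y) = twisted_comm Q (\<pi> x) (\<pi> y)"
        and N: "\<And>x y. x \<in> E \<Longrightarrow> y \<in> E \<Longrightarrow> comm G x y \<in> ?N \<longleftrightarrow> \<pi> x \<otimes>\<^bsub>Q\<^esub> \<pi> y = \<pi> y \<otimes>\<^bsub>Q\<^esub> \<pi> x"
      have e: "\<pi> v = twisted_comm Q (inv\<^bsub>Q\<^esub> \<pi> z) (\<pi> t)" "\<pi> w = twisted_comm Q (inv\<^bsub>Q\<^esub> \<pi> z) (\<pi> a)"
        "\<pi> (twisted_comm G t a) = twisted_comm Q (\<pi> t) (\<pi> a)"
        using izE tE a zE by (simp_all add: v_def w_def tw i)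
      have "\<pi> z \<otimes>\<^bsub>Q\<^esub> twisted_comm Q (\<pi> t) (\<pi> a) = twisted_comm Q (\<pi> t) (\<pi> a) \<otimes>\<^bsub>Q\<^esub> \<pi> z"
      proof (rule group.commute_twisted_comm [OF Q], unfold e [symmetric])
        show "\<pi> v \<otimes>\<^bsub>Q\<^esub> \<pi> a = \<pi> a \<otimes>\<^bsub>Q\<^esub> \<pi> v" using vN [OF a] N [OF vE a] by blast
        show "\<pi> v \<otimes>\<^bsub>Q\<^esub> \<pi> t = \<pi> t \<otimes>\<^bsub>Q\<^esub> \<pi> v" using vN [OF tE] N [OF vE tE] by blast
        show "\<pi> v \<otimes>\<^bsub>Q\<^esub> \<pi> w = \<pi> w \<otimes>\<^bsub>Q\<^esub> \<pi> v" using vN [OF wE] N [OF vE wE] by blast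
        show "\<pi> w \<otimes>\<^bsub>Q\<^esub> \<pi> t = \<pi> t \<otimes>\<^bsub>Q\<^esub> \<pi> w" using wt N [OF wE tE] by blast
        show "\<pi> w \<otimes>\<^bsub>Q\<^esub> \<pi> (twisted_comm G t a) = \<pi> (twisted_comm G t a) \<otimes>\<^bsub>Q\<^esub> \<pi> w"
          using ws N [OF wE sE] by blast
      qed (use c a tE zE in auto)
      then show "comm G z (twisted_comm G t a) \<in> ?N" using N [OF zE sE] e by simp
    qed
  qed
  then show ?thesis using sE by (simp add: central_commuting_def)
qed

section \<open>Trading central depth for iterated commutators\<close>

lemma ball_lists_Suc:
  "(\<forall>as \<in> lists A. length as = Suc r \<longrightarrow> P as) \<longleftrightarrow>
    (\<forall>a \<in> A. \<forall>as \<in> lists A. length as = r \<longrightarrow> P (a # as))"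
proof (intro iffI ballI impI)
  fix a as
  assume *: "\<forall>as \<in> lists A. length as = Suc r \<longrightarrow> P as" "a \<in> A" "as \<in> lists A" "length as = r"
  then have "a # as \<in> lists A" by simp
  then show "P (a # as)" using * by auto
next
  fix as
  assume *: "\<forall>a \<in> A. \<forall>as \<in> lists A. length as = r \<longrightarrow> P (a # as)" "as \<in> lists A" "length as = Suc r"
  then obtain a as' where "as = a # as'" by (cases as) auto
  then show "P as" using * by auto
qed

text \<open>Each step of the induction lowers the centre by one: \<open>inv_A\<close> replaces
  $[x, t]$ in $Z_{r+1}$ by all $[[x, t], a]$ in $Z_r$, and \<open>commute_comm_iff\<close> modulo
  $Z_r$ replaces these by $[x, s]$ with \<open>s\<close> the twisted commutator of \<open>t\<close>
  and \<open>a\<close>. The weight \<open>Suc (k - r)\<close> of \<open>t\<close> grows as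
  \<open>r\<close> falls, just enough for the twisted commutator of \<open>x\<close> and
  \<open>a\<close>, which lies in $Z_k$, to commute with \<open>t\<close> and \<open>s\<close>
  modulo $Z_r$.\<close>

lemma comm_upper_central_iff:
  assumes E: "subgroup E G" and A: "A \<subseteq> E"
    and inv_A: "\<And>i x. i < k \<Longrightarrow> x \<in> E \<Longrightarrow> \<forall>a \<in> A. comm G x a \<in> upper_central G E i \<Longrightarrow>
      x \<in> upper_central G E (Suc i)"
    and x: "x \<in> E" and xA: "\<forall>a \<in> A. comm G x a \<in> upper_central G E k"
    and "r \<le> k" and "t \<in> central_commuting E (Suc (k - r))"
  shows "comm G x t \<in> upper_central G E r \<longleftrightarrow>
    (\<forall>as \<in> lists A. length as = r \<longrightarrow> x \<otimes> foldl (twisted_comm G) t as = foldl (twisted_comm G) t as \<otimes> x)"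
  using assms(6,7)
proof (induction r arbitrary: t)
  case 0
  then have "t \<in> E" by (simp add: central_commuting_def)
  then show ?case using x by (simp add: comm_eq_one_iff subgroup.mem_carrier [OF E])
next
  case (Suc r)
  note mem = subgroup.mem_carrier [OF E]
  have tE: "t \<in> E"
    and tc: "\<And>m z. z \<in> upper_central G E m \<Longrightarrow> comm G z t \<in> upper_central G E (m - (k - r))"
    using Suc.prems by (auto simp: central_commuting_def Suc_diff_le Suc_diff_Suc)
  have step: "comm G (comm G x t) a \<in> upper_central G E r \<longleftrightarrow>
      comm G x (twisted_comm G t a) \<in> upper_central G E r" if "a \<in> A" for a
  proof -
    have aE: "a \<in> E" using that A by blast
    define z where "z = twisted_comm G x a"
    define s where "s = twisted_comm G t a"
    have zE: "z \<in> E" and sE: "s \<in> E" and xtE: "comm G x t \<in> E"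
      using aE x tE E by (simp_all add: z_def s_def twisted_comm_in_subgroup comm_in_subgroup)
    have "comm G a x \<in> upper_central G E k"
      using xA that comm_swap_in [OF upper_central_subgroup [OF E]] mem x aE by blast
    \<comment> \<open>\<open>z\<close> is the conjugate of $[a, x]$ by $(xa)^{-1}$.\<close>
    then have "inv (x \<otimes> a) \<otimes> comm G a x \<otimes> inv (inv (x \<otimes> a)) \<in> upper_central G E k"
      using upper_central_conj [OF E] subgroup.m_inv_closed [OF E] subgroup.m_closed [OF E] x aE by blast
    moreover have "inv (x \<otimes> a) \<otimes> comm G a x \<otimes> inv (inv (x \<otimes> a)) = z"
      using x aE mem by (simp add: z_def comm_def twisted_comm_def word_simps)
    ultimately have zk: "z \<in> upper_central G E k" by simp
    have zt: "comm G z t \<in> upper_central G E r"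
      using tc [OF zk] Suc.prems by simp
    \<comment> \<open>The weight of \<open>s\<close> is one more than that of \<open>t\<close>, so
      \<open>z\<close> commutes with \<open>s\<close> even modulo the centre below $Z_r(E)$ (or
      $Z_0(E)$ if $r = 0$), which is then enlarged to $Z_r(E)$.\<close>
    have "s \<in> central_commuting E (Suc (Suc (k - Suc r)))"
      unfolding s_def using twisted_comm_central_commuting [OF E Suc.prems(2) aE] .
    moreover have "Suc (Suc (k - Suc r)) = Suc (k - r)" using Suc.prems(1) by simp
    ultimately have "comm G z s \<in> upper_central G E (k - Suc (k - r))"
      using zk by (simp only: central_commuting_def) blast
    then have zs: "comm G z s \<in> upper_central G E r"
      using upper_central_mono [OF E, of "k - Suc (k - r)" r] Suc.prems(1) by auto
    show ?thesis
    proof (rule upper_central_quotient [OF E, of r])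
      fix Q :: "'a set monoid" and \<pi>
      assume Q: "group Q"
        and c: "\<And>x. x \<in> E \<Longrightarrow> \<pi> x \<in> carrier Q"
        and cm: "\<And>x y. x \<in> E \<Longrightarrow> y \<in> E \<Longrightarrow> \<pi> (comm G x y) = comm Q (\<pi> x) (\<pi> y)"
        and tw: "\<And>x y. x \<in> E \<Longrightarrow> y \<in> E \<Longrightarrow> \<pi> (twisted_comm G x y) = twisted_comm Q (\<pi> x) (\<pi> y)"
        and N: "\<And>x y. x \<in> E \<Longrightarrow> y \<in> E \<Longrightarrow>
          comm G x y \<in> upper_central G E r \<longleftrightarrow> \<pi> x \<otimes>\<^bsub>Q\<^esub> \<pi> y = \<pi> y \<otimes>\<^bsub>Q\<^esub> \<pi> x"
      have e: "\<pi> z = twisted_comm Q (\<pi> x) (\<pi> a)" "\<pi> s = twisted_comm Q (\<pi> t) (\<pi> a)"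
        "\<pi> (comm G x t) = comm Q (\<pi> x) (\<pi> t)"
        using x aE tE by (simp_all add: z_def s_def tw cm)
      have "\<pi> (comm G x t) \<otimes>\<^bsub>Q\<^esub> \<pi> a = \<pi> a \<otimes>\<^bsub>Q\<^esub> \<pi> (comm G x t) \<longleftrightarrow> \<pi> x \<otimes>\<^bsub>Q\<^esub> \<pi> s = \<pi> s \<otimes>\<^bsub>Q\<^esub> \<pi> x"
        unfolding e
      proof (rule group.commute_comm_iff [OF Q], unfold e [symmetric])
        show "\<pi> z \<otimes>\<^bsub>Q\<^esub> \<pi> t = \<pi> t \<otimes>\<^bsub>Q\<^esub> \<pi> z" using zt N [OF zE tE] by blast
        show "\<pi> z \<otimes>\<^bsub>Q\<^esub> \<pi> s = \<pi> s \<otimes>\<^bsub>Q\<^esub> \<pi> z" using zs N [OF zE sE] by blast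
      qed (use c x aE tE in auto)
      then show ?thesis using N [OF xtE aE] N [OF x sE] by (simp add: s_def)
    qed
  qed
  have "comm G x t \<in> upper_central G E (Suc r) \<longleftrightarrow>
      (\<forall>a \<in> A. comm G (comm G x t) a \<in> upper_central G E r)"
    using inv_A [of r "comm G x t"] Suc.prems(1) comm_in_subgroup [OF E x tE] A by auto
  also have "\<dots> \<longleftrightarrow> (\<forall>a \<in> A. comm G x (twisted_comm G t a) \<in> upper_central G E r)"
    using step by blast
  also have "\<dots> \<longleftrightarrow> (\<forall>a \<in> A. \<forall>as \<in> lists A. length as = r \<longrightarrow>
      x \<otimes> foldl (twisted_comm G) (twisted_comm G t a) as =
      foldl (twisted_comm G) (twisted_comm G t a) as \<otimes> x)"
  proof (rule ball_cong [OF refl])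
    fix a assume "a \<in> A"
    then have "twisted_comm G t a \<in> central_commuting E (Suc (Suc (k - Suc r)))"
      using twisted_comm_central_commuting [OF E Suc.prems(2)] A by blast
    then have "twisted_comm G t a \<in> central_commuting E (Suc (k - r))"
      using Suc.prems(1) by (simp add: Suc_diff_Suc Suc_le_lessD)
    then show "comm G x (twisted_comm G t a) \<in> upper_central G E r \<longleftrightarrow> (\<forall>as \<in> lists A. length as = r \<longrightarrow>
      x \<otimes> foldl (twisted_comm G) (twisted_comm G t a) as =
      foldl (twisted_comm G) (twisted_comm G t a) as \<otimes> x)"
      using Suc.IH Suc.prems(1) by simp
  qed
  also have "\<dots> \<longleftrightarrow> (\<forall>as \<in> lists A. length as = Suc r \<longrightarrow>
      x \<otimes> foldl (twisted_comm G) t as = foldl (twisted_comm G) t as \<otimes> x)"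
    unfolding ball_lists_Suc by simp
  finally show ?case .
qed

end

section \<open>The descending sequence of envelopes\<close>

text \<open>For constant \<open>B = (\<lambda>_. H)\<close>, the next envelope is the double centralizer of \<open>H\<close> modulo the
  \<open>k\<close>-th centre. Other values of \<open>B\<close> replace \<open>H\<close> by finitely many of its elements.\<close>

primrec envelope :: "('a, 'b) monoid_scheme \<Rightarrow> (nat \<Rightarrow> 'a set) \<Rightarrow> nat \<Rightarrow> 'a set" where
  "envelope G B 0 = carrier G"
| "envelope G B (Suc k) = {g \<in> envelope G B k. \<forall>x \<in> envelope G B k.
     (\<forall>b \<in> B k. comm G x b \<in> upper_central G (envelope G B k) k) \<longrightarrow>
     comm G x g \<in> upper_central G (envelope G B k) k}"

context group
begin

lemma centralizer_modulo_subgroup: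
  assumes E: "subgroup E G" and X: "X \<subseteq> E"
  shows "subgroup {g \<in> E. \<forall>x \<in> X. comm G x g \<in> upper_central G E i} G"
proof -
  let ?Z = "upper_central G E i"
  note sub = upper_central_subgroup [OF E, of i]
  note mem = subgroup.mem_carrier [OF E]
  \<comment> \<open>The commutator is turned round so that the expansions in the left argument,
    \<open>comm_mult_left\<close> and \<open>comm_inv_left\<close>, give closure.\<close>
  have sw: "comm G x g \<in> ?Z \<longleftrightarrow> comm G g x \<in> ?Z" if "x \<in> X" "g \<in> E" for x g
    using comm_swap_in [OF sub] that X mem by blast
  have eq: "{g \<in> E. \<forall>x \<in> X. comm G x g \<in> ?Z} = {g \<in> E. \<forall>x \<in> X. comm G g x \<in> ?Z}"
    using sw by blast
  have c: "x \<in> carrier G" "x \<in> E" if "x \<in> X" for x using that X mem by auto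
  show ?thesis unfolding eq
  proof
    show "{g \<in> E. \<forall>x \<in> X. comm G g x \<in> ?Z} \<subseteq> carrier G" using mem by blast
    show "\<one> \<in> {g \<in> E. \<forall>x \<in> X. comm G g x \<in> ?Z}"
      using c by (simp add: subgroup.one_closed [OF E] subgroup.one_closed [OF sub])
    show "g \<otimes> g' \<in> {g \<in> E. \<forall>x \<in> X. comm G g x \<in> ?Z}"
      if "g \<in> {g \<in> E. \<forall>x \<in> X. comm G g x \<in> ?Z}" "g' \<in> {g \<in> E. \<forall>x \<in> X. comm G g x \<in> ?Z}" for g g'
      using that c mem
      by (auto simp: comm_mult_left subgroup.m_closed [OF E]
          intro!: subgroup.m_closed [OF sub] upper_central_conj [OF E])
    show "inv g \<in> {g \<in> E. \<forall>x \<in> X. comm G g x \<in> ?Z}"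
      if g: "g \<in> {g \<in> E. \<forall>x \<in> X. comm G g x \<in> ?Z}" for g
    proof -
      have gE: "g \<in> E" "inv g \<in> E" "g \<in> carrier G"
        using g mem subgroup.m_inv_closed [OF E] by auto
      have "inv g \<otimes> inv (comm G g x) \<otimes> inv (inv g) \<in> ?Z" if "x \<in> X" for x
        using upper_central_conj [OF E gE(2)] subgroup.m_inv_closed [OF sub] g that by blast
      then show ?thesis using gE c by (simp add: comm_inv_left)
    qed
  qed
qed

lemma envelope_subgroup: "subgroup (envelope G B k) G"
proof (induction k)
  case 0
  show ?case by (simp add: subgroup_self)
next
  case (Suc k)
  let ?E = "envelope G B k"
  define X where "X = {x \<in> ?E. \<forall>b \<in> B k. comm G x b \<in> upper_central G ?E k}"
  have "envelope G B (Suc k) = {g \<in> ?E. \<forall>x \<in> X. comm G x g \<in> upper_central G ?E k}"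
    by (auto simp: X_def)
  then show ?case
    using centralizer_modulo_subgroup [OF Suc, of X k] by (simp add: X_def)
qed

section \<open>Stability of the upper central series along the envelopes\<close>

lemma envelope_antimono: "i \<le> j \<Longrightarrow> envelope G B j \<subseteq> envelope G B i"
  by (rule lift_Suc_antimono_le [of "envelope G B"]) auto

lemma subset_envelope: "H \<subseteq> carrier G \<Longrightarrow> H \<subseteq> envelope G (\<lambda>_. H) k"
  by (induction k) auto

text \<open>From left to right: \<open>H\<close> lies in the smaller envelope and, by
  \<open>P\<close>, already detects the centres of the larger one. From right to left: $Z_i(E_k)$
  lies in $Z_k(E_k)$ and therefore survives into $E_{k+1}$. \<open>P\<close> is a hypothesis because
  it comes out of the induction on \<open>k\<close> in which this lemma is applied.\<close>

lemma upper_central_envelope_aux: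
  assumes H: "H \<subseteq> carrier G"
    and P: "\<And>i x. i < k \<Longrightarrow> x \<in> envelope G (\<lambda>_. H) k \<Longrightarrow>
      \<forall>h \<in> H. comm G x h \<in> upper_central G (envelope G (\<lambda>_. H) k) i \<Longrightarrow>
      x \<in> upper_central G (envelope G (\<lambda>_. H) k) (Suc i)"
    and "i \<le> k"
  shows "upper_central G (envelope G (\<lambda>_. H) (Suc k)) i = upper_central G (envelope G (\<lambda>_. H) k) i"
  using \<open>i \<le> k\<close>
proof (induction i)
  case 0
  show ?case by simp
next
  case (Suc i)
  let ?E = "envelope G (\<lambda>_. H) k" and ?E' = "envelope G (\<lambda>_. H) (Suc k)"
  have sE: "subgroup ?E G" by (rule envelope_subgroup)
  have EE: "?E' \<subseteq> ?E" by auto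
  have IH: "upper_central G ?E' i = upper_central G ?E i" using Suc by simp
  show ?case
  proof
    show "upper_central G ?E' (Suc i) \<subseteq> upper_central G ?E (Suc i)"
    proof
      fix x assume x: "x \<in> upper_central G ?E' (Suc i)"
      have "comm G x h \<in> upper_central G ?E i" if "h \<in> H" for h
      proof -
        have "h \<in> ?E'" using that subset_envelope [OF H] by blast
        then show ?thesis using x IH by (simp only: upper_central.simps) blast
      qed
      moreover have "x \<in> ?E" using x by simp
      ultimately show "x \<in> upper_central G ?E (Suc i)" using P Suc.prems by simp
    qed
    show "upper_central G ?E (Suc i) \<subseteq> upper_central G ?E' (Suc i)"
    proof
      fix z assume z: "z \<in> upper_central G ?E (Suc i)"
      then have zE: "z \<in> ?E" by simp
      have zk: "z \<in> upper_central G ?E k" using z upper_central_mono [OF sE Suc.prems] by blast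
      have "comm G z x \<in> upper_central G ?E k" if "x \<in> ?E" for x
        using comm_in_normalized [OF sE upper_central_subgroup [OF sE] upper_central_subset [OF sE]
          upper_central_conj [OF sE] zk that] .
      then have "comm G x z \<in> upper_central G ?E k" if "x \<in> ?E" for x
        using comm_swap_in [OF upper_central_subgroup [OF sE]] that zE subgroup.mem_carrier [OF sE] by blast
      then have "z \<in> ?E'" using zE by simp
      moreover have "comm G z y \<in> upper_central G ?E' i" if "y \<in> ?E'" for y
        using z that IH EE by (simp only: upper_central.simps) blast
      ultimately show "z \<in> upper_central G ?E' (Suc i)" by (simp only: upper_central.simps) blast
    qed
  qed
qed

text \<open>For the lower centres the claim is inherited from the previous level by stability. The
  new top case holds by construction: elements of $E_{k+1}$ commute modulo $Z_k(E_k)$ with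
  everything in $E_k$ that centralizes \<open>H\<close> modulo $Z_k(E_k)$.\<close>

lemma upper_central_envelope_iff:
  assumes H: "H \<subseteq> carrier G" and "i < k" and x: "x \<in> envelope G (\<lambda>_. H) k"
    and "\<forall>h \<in> H. comm G x h \<in> upper_central G (envelope G (\<lambda>_. H) k) i"
  shows "x \<in> upper_central G (envelope G (\<lambda>_. H) k) (Suc i)"
  using assms(2-)
proof (induction k arbitrary: i x)
  case 0
  then show ?case by simp
next
  case (Suc k)
  let ?E = "envelope G (\<lambda>_. H) k" and ?E' = "envelope G (\<lambda>_. H) (Suc k)"
  have st: "upper_central G ?E' j = upper_central G ?E j" if "j \<le> k" for j
    using upper_central_envelope_aux [OF H Suc.IH that] by blast
  have xE: "x \<in> ?E" using Suc.prems(2) by simp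
  have xH: "\<forall>h \<in> H. comm G x h \<in> upper_central G ?E i"
    using Suc.prems(1,3) st [of i] by simp
  show ?case
  proof (cases "i < k")
    case True
    then show ?thesis using Suc.IH [OF True xE xH] st [of "Suc i"] by simp
  next
    case False
    then have i: "i = k" using Suc.prems by simp
    have "comm G x y \<in> upper_central G ?E k" if "y \<in> ?E'" for y
      using that xE xH i by simp
    then show ?thesis using Suc.prems(2) st [of k] i by (simp only: upper_central.simps) blast
  qed
qed

lemma upper_central_envelope_stable:
  assumes H: "H \<subseteq> carrier G" and "i \<le> j" "j \<le> k"
  shows "upper_central G (envelope G (\<lambda>_. H) k) i = upper_central G (envelope G (\<lambda>_. H) j) i"
  using \<open>j \<le> k\<close>
proof (induction k rule: dec_induct)
  case (step k)
  have "upper_central G (envelope G (\<lambda>_. H) (Suc k)) i = upper_central G (envelope G (\<lambda>_. H) k) i"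
    using step.hyps \<open>i \<le> j\<close> by (intro upper_central_envelope_aux [OF H upper_central_envelope_iff [OF H]]) auto
  then show ?case using step.IH by (rule trans)
qed simp

text \<open>\<open>A\<close> collects the elements chosen at lower levels; \<open>K\<close> is the
  set of admissible cardinalities, which will be \<open>UNIV\<close> under the chain condition and
  \<open>{..d}\<close> in c-dimension \<open>d\<close>. A set \<open>B\<close> controlling the
  centralizer of all \<open>k\<close>-fold commutators consists of such commutators, and their later
  entries are in \<open>A\<close>. It therefore suffices to add their initial entries.\<close>

lemma finite_test_set_step:
  assumes H: "subgroup H G" and A: "A \<subseteq> H"
    and inv_A: "\<And>i x. i < k \<Longrightarrow> x \<in> envelope G (\<lambda>_. H) k \<Longrightarrow>
      \<forall>a \<in> A. comm G x a \<in> upper_central G (envelope G (\<lambda>_. H) k) i \<Longrightarrow>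
      x \<in> upper_central G (envelope G (\<lambda>_. H) k) (Suc i)"
    and K: "\<And>S. S \<subseteq> carrier G \<Longrightarrow> \<exists>B \<subseteq> S. finite B \<and> card B \<in> K \<and> centralizer G B \<subseteq> centralizer G S"
    and down: "\<And>l m. m \<in> K \<Longrightarrow> l \<le> m \<Longrightarrow> l \<in> K"
  shows "\<exists>F \<subseteq> H. finite F \<and> card F \<in> K \<and>
    (\<forall>x \<in> envelope G (\<lambda>_. H) k.
      (\<forall>a \<in> A \<union> F. comm G x a \<in> upper_central G (envelope G (\<lambda>_. H) k) k) \<longrightarrow>
      (\<forall>h \<in> H. comm G x h \<in> upper_central G (envelope G (\<lambda>_. H) k) k))"
proof -
  let ?E = "envelope G (\<lambda>_. H) k"
  have sE: "subgroup ?E G" by (rule envelope_subgroup)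
  have Hc: "H \<subseteq> carrier G" using H by (rule subgroup.subset)
  have HE: "H \<subseteq> ?E" using subset_envelope [OF Hc] .
  have AE: "A \<subseteq> ?E" using A HE by blast
  define tc where "tc h as = foldl (twisted_comm G) h as" for h as
  define S where "S = {tc h as | h as. h \<in> H \<and> as \<in> lists A \<and> length as = k}"
  have tcH: "tc h as \<in> H" if "h \<in> H" "as \<in> lists A" for h as
    using that unfolding tc_def
  proof (induction as arbitrary: h)
    case (Cons a as)
    then show ?case using A twisted_comm_in_subgroup [OF H] by auto
  qed simp
  have "S \<subseteq> carrier G" using tcH Hc by (auto simp: S_def)
  then obtain B where B: "B \<subseteq> S" "finite B" "card B \<in> K" "centralizer G B \<subseteq> centralizer G S"
    using K by blast
  have "\<forall>b \<in> B. \<exists>h. h \<in> H \<and> (\<exists>as \<in> lists A. length as = k \<and> b = tc h as)"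
    using B(1) unfolding S_def by blast
  \<comment> \<open>\<open>f\<close> selects one initial entry for each element of \<open>B\<close>,
    so the new set is no larger than \<open>B\<close>.\<close>
  from bchoice [OF this] obtain f where
    f': "\<forall>b \<in> B. f b \<in> H \<and> (\<exists>as \<in> lists A. length as = k \<and> b = tc (f b) as)" ..
  then have f: "\<And>b. b \<in> B \<Longrightarrow> f b \<in> H"
    "\<And>b. b \<in> B \<Longrightarrow> \<exists>as \<in> lists A. length as = k \<and> b = tc (f b) as" by simp_all
  have key: "comm G x t \<in> upper_central G ?E k \<longleftrightarrow>
      (\<forall>as \<in> lists A. length as = k \<longrightarrow> x \<otimes> tc t as = tc t as \<otimes> x)"
    if "x \<in> ?E" "\<forall>a \<in> A. comm G x a \<in> upper_central G ?E k" "t \<in> ?E" for x t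
    unfolding tc_def
  proof (rule comm_upper_central_iff [OF sE AE _ that(1,2) order_refl])
    \<comment> \<open>For $r = k$ the required weight is 1, which every element of the envelope
      has.\<close>
    show "t \<in> central_commuting ?E (Suc (k - k))"
      using central_commuting_Suc_0 [OF sE that(3)] by simp
  qed (rule inv_A)
  have "comm G x h \<in> upper_central G ?E k"
    if x: "x \<in> ?E" and xa: "\<forall>a \<in> A \<union> f ` B. comm G x a \<in> upper_central G ?E k" and h: "h \<in> H" for x h
  proof -
    have xA: "\<forall>a \<in> A. comm G x a \<in> upper_central G ?E k" using xa by blast
    have "x \<otimes> b = b \<otimes> x" if "b \<in> B" for b
    proof -
      obtain as where "as \<in> lists A" "length as = k" "b = tc (f b) as" using f(2) [OF \<open>b \<in> B\<close>] by blast
      moreover have "comm G x (f b) \<in> upper_central G ?E k" using xa that by blast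
      ultimately show ?thesis using key [OF x xA, of "f b"] f(1) [OF \<open>b \<in> B\<close>] HE by (metis subsetD)
    qed
    then have "x \<in> centralizer G B" using subgroup.mem_carrier [OF sE x] by (simp add: centralizer_def)
    then have "x \<in> centralizer G S" using B(4) by blast
    then have "\<forall>as \<in> lists A. length as = k \<longrightarrow> x \<otimes> tc h as = tc h as \<otimes> x"
      using h by (auto simp: centralizer_def S_def)
    then show ?thesis using key [OF x xA] h HE by blast
  qed
  moreover have "card (f ` B) \<in> K" using down [OF B(3)] card_image_le [OF B(2)] by blast
  moreover have "f ` B \<subseteq> H" using f(1) by blast
  ultimately show ?thesis using B(2) by (intro exI [of _ "f ` B"]) blast
qed

text \<open>Each level is judged by the envelopes of \<open>H\<close>, not by those built from
  \<open>B\<close>; that the two coincide then follows by induction on the level.\<close>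

definition test_sets :: "'a set \<Rightarrow> (nat \<Rightarrow> 'a set) \<Rightarrow> nat \<Rightarrow> bool" where
  "test_sets H B n \<longleftrightarrow> (\<forall>k < n. B k \<subseteq> H \<and> (\<forall>x \<in> envelope G (\<lambda>_. H) k.
     (\<forall>b \<in> B k. comm G x b \<in> upper_central G (envelope G (\<lambda>_. H) k) k) \<longrightarrow>
     (\<forall>h \<in> H. comm G x h \<in> upper_central G (envelope G (\<lambda>_. H) k) k)))"

lemma test_setsD:
  assumes "test_sets H B n" "k < n"
  shows "B k \<subseteq> H"
    and "x \<in> envelope G (\<lambda>_. H) k \<Longrightarrow>
      \<forall>b \<in> B k. comm G x b \<in> upper_central G (envelope G (\<lambda>_. H) k) k \<Longrightarrow>
      \<forall>h \<in> H. comm G x h \<in> upper_central G (envelope G (\<lambda>_. H) k) k"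
  using assms by (simp_all only: test_sets_def) simp_all

lemma envelope_test_sets:
  assumes "test_sets H B n" "k \<le> n"
  shows "envelope G B k = envelope G (\<lambda>_. H) k"
  using \<open>k \<le> n\<close>
proof (induction k)
  case (Suc k)
  then have IH: "envelope G B k = envelope G (\<lambda>_. H) k" by simp
  have B: "B k \<subseteq> H" and t: "\<And>x. x \<in> envelope G (\<lambda>_. H) k \<Longrightarrow>
      (\<forall>b \<in> B k. comm G x b \<in> upper_central G (envelope G (\<lambda>_. H) k) k) \<Longrightarrow>
      (\<forall>h \<in> H. comm G x h \<in> upper_central G (envelope G (\<lambda>_. H) k) k)"
    by (fact test_setsD [OF assms(1) Suc_le_lessD [OF Suc.prems]])+
  have "(\<forall>b \<in> B k. comm G x b \<in> upper_central G (envelope G (\<lambda>_. H) k) k) \<longleftrightarrow>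
      (\<forall>h \<in> H. comm G x h \<in> upper_central G (envelope G (\<lambda>_. H) k) k)"
    if "x \<in> envelope G (\<lambda>_. H) k" for x
    using t [OF that] B by blast
  then show ?case by (auto simp: IH)
qed simp

text \<open>The test sets are cumulative because the elements chosen at earlier levels must detect
  the lower centres of the next envelope. Since the earlier elements are reused, level
  \<open>k\<close> still costs only the elements of \<open>A k\<close>.\<close>

lemma finite_test_sets:
  assumes H: "subgroup H G"
    and K: "\<And>S. S \<subseteq> carrier G \<Longrightarrow> \<exists>B \<subseteq> S. finite B \<and> card B \<in> K \<and> centralizer G B \<subseteq> centralizer G S"
    and down: "\<And>l m. m \<in> K \<Longrightarrow> l \<le> m \<Longrightarrow> l \<in> K"
  shows "\<exists>A. (\<forall>k < n. finite (A k) \<and> card (A k) \<in> K \<and> A k \<subseteq> H) \<and> test_sets H (\<lambda>k. \<Union>j \<le> k. A j) n"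
proof (induction n)
  case 0
  show ?case by (simp add: test_sets_def)
next
  case (Suc n)
  then obtain A where A: "\<And>k. k < n \<Longrightarrow> finite (A k) \<and> card (A k) \<in> K \<and> A k \<subseteq> H"
    and t: "test_sets H (\<lambda>k. \<Union>j \<le> k. A j) n" by blast
  let ?A = "\<Union>j < n. A j"
  have Hc: "H \<subseteq> carrier G" using H by (rule subgroup.subset)
  have AH: "?A \<subseteq> H" using A by blast
  have inv_A: "x \<in> upper_central G (envelope G (\<lambda>_. H) n) (Suc i)"
    if i: "i < n" and x: "x \<in> envelope G (\<lambda>_. H) n"
      and xa: "\<forall>a \<in> ?A. comm G x a \<in> upper_central G (envelope G (\<lambda>_. H) n) i" for i x
  proof -
    \<comment> \<open>Stability moves the test from $E_n$ down to $E_i$, where the induction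
      hypothesis knows a test set.\<close>
    have st: "upper_central G (envelope G (\<lambda>_. H) n) i = upper_central G (envelope G (\<lambda>_. H) i) i"
      using upper_central_envelope_stable [OF Hc] i by simp
    have "x \<in> envelope G (\<lambda>_. H) i" using x envelope_antimono [of i n] i by auto
    moreover have "\<forall>a \<in> (\<Union>j \<le> i. A j). comm G x a \<in> upper_central G (envelope G (\<lambda>_. H) i) i"
      using xa i st by auto
    ultimately have "\<forall>h \<in> H. comm G x h \<in> upper_central G (envelope G (\<lambda>_. H) i) i"
      by (rule test_setsD(2) [OF t i])
    then show ?thesis using upper_central_envelope_iff [OF Hc i x] st by simp
  qed
  have "\<exists>F \<subseteq> H. finite F \<and> card F \<in> K \<and>
    (\<forall>x \<in> envelope G (\<lambda>_. H) n.
      (\<forall>a \<in> ?A \<union> F. comm G x a \<in> upper_central G (envelope G (\<lambda>_. H) n) n) \<longrightarrow>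
      (\<forall>h \<in> H. comm G x h \<in> upper_central G (envelope G (\<lambda>_. H) n) n))"
    by (rule finite_test_set_step [OF H AH inv_A K down])
  then obtain F where F: "F \<subseteq> H" "finite F" "card F \<in> K"
    "\<forall>x \<in> envelope G (\<lambda>_. H) n.
      (\<forall>a \<in> ?A \<union> F. comm G x a \<in> upper_central G (envelope G (\<lambda>_. H) n) n) \<longrightarrow>
      (\<forall>h \<in> H. comm G x h \<in> upper_central G (envelope G (\<lambda>_. H) n) n)"
    by (elim exE conjE)
  have U: "(\<Union>j \<le> k. (A(n := F)) j) = (if k < n then \<Union>j \<le> k. A j else ?A \<union> F)" if "k < Suc n" for k
  proof (cases "k < n")
    case True
    then have "(\<Union>j \<le> k. (A(n := F)) j) = (\<Union>j \<le> k. A j)" by (intro SUP_cong) auto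
    then show ?thesis using True by simp
  next
    case False
    then have "{..k} = insert n {..<n}" using that by auto
    moreover have "(\<Union>j < n. (A(n := F)) j) = ?A" by (intro SUP_cong) auto
    ultimately show ?thesis using False by auto
  qed
  have "test_sets H (\<lambda>k. \<Union>j \<le> k. (A(n := F)) j) (Suc n)"
    unfolding test_sets_def
  proof (intro allI impI)
    fix k assume k: "k < Suc n"
    show "(\<Union>j \<le> k. (A(n := F)) j) \<subseteq> H \<and> (\<forall>x \<in> envelope G (\<lambda>_. H) k.
     (\<forall>b \<in> (\<Union>j \<le> k. (A(n := F)) j). comm G x b \<in> upper_central G (envelope G (\<lambda>_. H) k) k) \<longrightarrow>
     (\<forall>h \<in> H. comm G x h \<in> upper_central G (envelope G (\<lambda>_. H) k) k))"
    proof (cases "k < n")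
      case True
      then show ?thesis using t unfolding U [OF k] test_sets_def by simp
    next
      case False
      then have "k = n" using k by simp
      then show ?thesis unfolding U [OF k] using AH F(1,4) by auto
    qed
  qed
  then show ?case using A F by (intro exI [of _ "A(n := F)"]) (auto simp: less_Suc_eq)
qed

end

section \<open>Nilpotence class, normalizers and chains of centralizers\<close>

text \<open>For a subgroup this says that the class is at most \<open>n\<close>. In this form it
  passes to subsets, and its failure is witnessed by finitely many elements, as the reduction to
  countable groups requires.\<close>

definition trivial_iterated_comms :: "('a, 'b) monoid_scheme \<Rightarrow> 'a set \<Rightarrow> nat \<Rightarrow> bool" where
  "trivial_iterated_comms G E n \<longleftrightarrow>
     (\<forall>x \<in> E. \<forall>ys \<in> lists E. length ys = n \<longrightarrow> foldl (comm G) x ys = \<one>\<^bsub>G\<^esub>)"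

context group
begin

section \<open>Nilpotence class through iterated commutators\<close>

lemma mem_upper_central_iff:
  assumes E: "subgroup E G" and "x \<in> E"
  shows "x \<in> upper_central G E n \<longleftrightarrow>
    (\<forall>ys \<in> lists E. length ys = n \<longrightarrow> foldl (comm G) x ys = \<one>)"
  using \<open>x \<in> E\<close>
proof (induction n arbitrary: x)
  case (Suc n)
  have "comm G x y \<in> upper_central G E n \<longleftrightarrow>
      (\<forall>ys \<in> lists E. length ys = n \<longrightarrow> foldl (comm G) (comm G x y) ys = \<one>)" if "y \<in> E" for y
    using Suc.IH [OF comm_in_subgroup [OF E Suc.prems that]] .
  then show ?case using Suc.prems unfolding ball_lists_Suc by simp
qed simp

lemma trivial_iterated_comms_iff:
  "subgroup E G \<Longrightarrow> trivial_iterated_comms G E n \<longleftrightarrow> E \<subseteq> upper_central G E n"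
  unfolding trivial_iterated_comms_def subset_iff using mem_upper_central_iff [of E _ n] by blast

lemma lower_central_subset: "lower_central G k \<subseteq> carrier G"
proof (induction k)
  case (Suc k)
  then show ?case
    unfolding lower_central.simps commutator_subgroup_def
    by (intro generate_incl) auto
qed simp

text \<open>The two series are run against each other: \<open>lower_central G (n - i)\<close> lies
  in the \<open>i\<close>-th centre in one direction, \<open>lower_central G j\<close> in the centre
  of index \<open>n - j\<close> in the other.\<close>

lemma lower_central_trivial_iff_upper_central:
  "lower_central G n = {\<one>} \<longleftrightarrow> carrier G \<subseteq> upper_central G (carrier G) n"
proof
  assume n: "lower_central G n = {\<one>}"
  have "lower_central G (n - i) \<subseteq> upper_central G (carrier G) i" if "i \<le> n" for i
    using that
  proof (induction i)
    case (Suc i)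
    have e: "Suc (n - Suc i) = n - i" using Suc.prems by simp
    show ?case
    proof
      fix x assume x: "x \<in> lower_central G (n - Suc i)"
      then have xc: "x \<in> carrier G" using lower_central_subset by blast
      have "comm G x y \<in> lower_central G (Suc (n - Suc i))" if "y \<in> carrier G" for y
        unfolding lower_central.simps commutator_subgroup_def comm_def
        by (rule generate.incl) (use x that in blast)
      then show "x \<in> upper_central G (carrier G) (Suc i)"
        using xc Suc unfolding e by auto
    qed
  qed (simp add: n)
  from this [of n] show "carrier G \<subseteq> upper_central G (carrier G) n" by simp
next
  note self = subgroup_self
  assume n: "carrier G \<subseteq> upper_central G (carrier G) n"
  have "lower_central G j \<subseteq> upper_central G (carrier G) (n - j)" if "j \<le> n" for j
    using that
  proof (induction j)
    case (Suc j)
    then have e: "n - j = Suc (n - Suc j)" by simp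
    have IH: "lower_central G j \<subseteq> upper_central G (carrier G) (Suc (n - Suc j))"
      using Suc e by simp
    show ?case
      unfolding lower_central.simps commutator_subgroup_def
    proof (rule generate_subgroup_incl [OF _ upper_central_subgroup [OF self]])
      show "(\<Union>a \<in> lower_central G j. \<Union>b \<in> carrier G. {a \<otimes> b \<otimes> inv a \<otimes> inv b})
          \<subseteq> upper_central G (carrier G) (n - Suc j)"
        using IH by (auto simp: comm_def)
    qed
  qed (simp add: n)
  from this [of n] have "lower_central G n \<subseteq> {\<one>}" by simp
  moreover have "\<one> \<in> lower_central G n"
    by (cases n) (auto simp: commutator_subgroup_def intro: generate.one)
  ultimately show "lower_central G n = {\<one>}" by blast
qed

lemma foldl_comm_subgroup:
  assumes H: "subgroup H G" and "x \<in> H" "ys \<in> lists H"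
  shows "foldl (comm (G\<lparr>carrier := H\<rparr>)) x ys = foldl (comm G) x ys"
  using assms(2-)
proof (induction ys arbitrary: x)
  case (Cons y ys)
  then have "comm (G\<lparr>carrier := H\<rparr>) x y = comm G x y"
    using H by (simp add: comm_def m_inv_consistent)
  then show ?case using Cons comm_in_subgroup [OF H] by simp
qed simp

lemma lower_central_subgroup_trivial_iff:
  assumes H: "subgroup H G"
  shows "lower_central (G\<lparr>carrier := H\<rparr>) n = {\<one>\<^bsub>G\<lparr>carrier := H\<rparr>\<^esub>} \<longleftrightarrow> trivial_iterated_comms G H n"
proof -
  interpret HG: group "G\<lparr>carrier := H\<rparr>" using H by (rule subgroup_imp_group)
  have s: "subgroup H (G\<lparr>carrier := H\<rparr>)" using HG.subgroup_self by simp
  have "trivial_iterated_comms (G\<lparr>carrier := H\<rparr>) H n \<longleftrightarrow> trivial_iterated_comms G H n"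
    unfolding trivial_iterated_comms_def using foldl_comm_subgroup [OF H] by simp
  then show ?thesis
    using HG.lower_central_trivial_iff_upper_central [of n] HG.trivial_iterated_comms_iff [OF s] by simp
qed

lemma nilpotent_of_class_iff:
  assumes H: "subgroup H G"
  shows "nilpotent_of_class (G\<lparr>carrier := H\<rparr>) n \<longleftrightarrow>
    trivial_iterated_comms G H n \<and> (\<forall>m < n. \<not> trivial_iterated_comms G H m)"
proof -
  have "nilpotent_of_class (G\<lparr>carrier := H\<rparr>) n \<longleftrightarrow> (\<exists>n. trivial_iterated_comms G H n) \<and>
      (LEAST n. trivial_iterated_comms G H n) = n"
    unfolding nilpotent_of_class_def nilpotent_def nilpotence_class_def
    using lower_central_subgroup_trivial_iff [OF H] by presburger
  also have "\<dots> \<longleftrightarrow> trivial_iterated_comms G H n \<and> (\<forall>m < n. \<not> trivial_iterated_comms G H m)"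
    by (metis LeastI Least_equality not_less not_less_Least)
  finally show ?thesis .
qed

lemma trivial_iterated_comms_mono:
  "trivial_iterated_comms G E n \<Longrightarrow> F \<subseteq> E \<Longrightarrow> trivial_iterated_comms G F n"
  unfolding trivial_iterated_comms_def by (meson lists_mono subsetD)

section \<open>Invariance under the normalizer\<close>

lemma mem_normalizer_iff:
  assumes "H \<subseteq> carrier G"
  shows "g \<in> normalizer G H \<longleftrightarrow> g \<in> carrier G \<and> (\<lambda>h. g \<otimes> h \<otimes> inv g) ` H = H"
proof -
  have "g <# H #> inv g = (\<lambda>h. g \<otimes> h \<otimes> inv g) ` H"
    by (auto simp: l_coset_def r_coset_def)
  then show ?thesis using assms by (auto simp: normalizer_def stabilizer_def)
qed

lemma inv_mem_normalizer:
  assumes H: "H \<subseteq> carrier G" and g: "g \<in> normalizer G H"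
  shows "inv g \<in> normalizer G H"
proof -
  have gc: "g \<in> carrier G" and e: "(\<lambda>h. g \<otimes> h \<otimes> inv g) ` H = H"
    using g mem_normalizer_iff [OF H] by auto
  have "(\<lambda>h. inv g \<otimes> h \<otimes> inv (inv g)) ` (\<lambda>h. g \<otimes> h \<otimes> inv g) ` H = (\<lambda>h. h) ` H"
    unfolding image_image using gc H by (intro image_cong) (auto simp: word_simps)
  then show ?thesis unfolding e mem_normalizer_iff [OF H] using gc by simp
qed

text \<open>Mapping \<open>D\<close> into itself is enough, since $g^{-1}$ also normalizes
  \<open>H\<close> and yields the reverse inclusion.\<close>

lemma normalizer_normal_iff:
  assumes H: "H \<subseteq> carrier G" and D: "D \<subseteq> carrier G"
  shows "normalizer_normal G D H \<longleftrightarrow> (\<forall>g \<in> normalizer G H. \<forall>x \<in> D. g \<otimes> x \<otimes> inv g \<in> D)"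
proof
  assume "normalizer_normal G D H"
  then show "\<forall>g \<in> normalizer G H. \<forall>x \<in> D. g \<otimes> x \<otimes> inv g \<in> D"
    unfolding normalizer_normal_def using mem_normalizer_iff [OF D] by blast
next
  assume *: "\<forall>g \<in> normalizer G H. \<forall>x \<in> D. g \<otimes> x \<otimes> inv g \<in> D"
  show "normalizer_normal G D H" unfolding normalizer_normal_def
  proof
    fix g assume g: "g \<in> normalizer G H"
    then have gc: "g \<in> carrier G" using mem_normalizer_iff [OF H] by simp
    have "x \<in> (\<lambda>h. g \<otimes> h \<otimes> inv g) ` D" if "x \<in> D" for x
    proof
      have "inv g \<otimes> x \<otimes> inv (inv g) \<in> D" using * inv_mem_normalizer [OF H g] that by blast
      then show "inv g \<otimes> x \<otimes> g \<in> D" using gc by simp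
      show "x = g \<otimes> (inv g \<otimes> x \<otimes> g) \<otimes> inv g" using gc that D by (auto simp: word_simps)
    qed
    then have "(\<lambda>h. g \<otimes> h \<otimes> inv g) ` D = D" using * g by blast
    then show "g \<in> normalizer G D" using gc mem_normalizer_iff [OF D] by simp
  qed
qed

lemma upper_central_invariant:
  assumes E: "subgroup E G" and S: "S \<subseteq> carrier G" "\<And>g. g \<in> S \<Longrightarrow> inv g \<in> S"
    and inv_E: "\<And>g x. g \<in> S \<Longrightarrow> x \<in> E \<Longrightarrow> g \<otimes> x \<otimes> inv g \<in> E"
    and "g \<in> S" "x \<in> upper_central G E i"
  shows "g \<otimes> x \<otimes> inv g \<in> upper_central G E i"
  using assms(6)
proof (induction i arbitrary: x)
  case 0
  then show ?case using S \<open>g \<in> S\<close> by auto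
next
  case (Suc i)
  have xE: "x \<in> E" using Suc.prems by simp
  have gc: "g \<in> carrier G" using S \<open>g \<in> S\<close> by blast
  have "comm G (g \<otimes> x \<otimes> inv g) y \<in> upper_central G E i" if y: "y \<in> E" for y
  proof -
    have "inv g \<otimes> y \<otimes> g \<in> E" using inv_E [OF S(2) [OF \<open>g \<in> S\<close>] y] gc by simp
    then have "g \<otimes> comm G x (inv g \<otimes> y \<otimes> g) \<otimes> inv g \<in> upper_central G E i"
      using Suc by simp
    then show ?thesis using comm_conj_left gc xE y subgroup.mem_carrier [OF E] by simp
  qed
  then show ?case using inv_E [OF \<open>g \<in> S\<close> xE] by simp
qed

text \<open>An element \<open>y\<close> to be tested against $g x g^{-1}$ is moved back by $g^{-1}$.
  As \<open>H\<close> and the \<open>k\<close>-th centre are invariant, the moved element still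
  centralizes \<open>H\<close> modulo that centre and can be tested against
  \<open>x\<close>.\<close>

lemma envelope_invariant:
  assumes S: "S \<subseteq> carrier G" "\<And>g. g \<in> S \<Longrightarrow> inv g \<in> S"
    and H: "H \<subseteq> carrier G" "\<And>g x. g \<in> S \<Longrightarrow> x \<in> H \<Longrightarrow> g \<otimes> x \<otimes> inv g \<in> H"
    and "g \<in> S" "x \<in> envelope G (\<lambda>_. H) k"
  shows "g \<otimes> x \<otimes> inv g \<in> envelope G (\<lambda>_. H) k"
  using assms(5,6)
proof (induction k arbitrary: g x)
  case 0
  then show ?case using S by auto
next
  case (Suc k)
  let ?E = "envelope G (\<lambda>_. H) k"
  have gc: "g \<in> carrier G" and ig: "inv g \<in> S" using S Suc.prems by auto
  have sE: "subgroup ?E G" by (rule envelope_subgroup)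
  have uc: "f \<otimes> y \<otimes> inv f \<in> upper_central G ?E k" if "f \<in> S" "y \<in> upper_central G ?E k" for f y
    by (rule upper_central_invariant [OF sE S Suc.IH that])
  have xE: "x \<in> ?E" using Suc.prems(2) by simp
  have xc: "x \<in> carrier G" using subgroup.mem_carrier [OF sE xE] .
  have "comm G y (g \<otimes> x \<otimes> inv g) \<in> upper_central G ?E k"
    if y: "y \<in> ?E" "\<forall>h \<in> H. comm G y h \<in> upper_central G ?E k" for y
  proof -
    have yc: "y \<in> carrier G" using subgroup.mem_carrier [OF sE y(1)] .
    let ?y = "inv g \<otimes> y \<otimes> inv (inv g)"
    have yE: "?y \<in> ?E" using Suc.IH [OF ig y(1)] .
    have "comm G ?y h \<in> upper_central G ?E k" if "h \<in> H" for h
    proof -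
      have "inv (inv g) \<otimes> h \<otimes> inv g \<in> H" using H(2) [OF Suc.prems(1) that] gc by simp
      then have "inv g \<otimes> comm G y (inv (inv g) \<otimes> h \<otimes> inv g) \<otimes> inv (inv g) \<in> upper_central G ?E k"
        using uc [OF ig] y(2) by blast
      moreover have "h \<in> carrier G" using that H by blast
      ultimately show ?thesis using gc yc by (subst comm_conj_left) auto
    qed
    then have "comm G ?y x \<in> upper_central G ?E k" using Suc.prems(2) yE by simp
    then have "g \<otimes> comm G ?y x \<otimes> inv g \<in> upper_central G ?E k" by (rule uc [OF Suc.prems(1)])
    also have "g \<otimes> comm G ?y x \<otimes> inv g = comm G y (g \<otimes> x \<otimes> inv g)"
      using gc yc xc by (simp add: comm_def word_simps)
    finally show ?thesis .
  qed
  then show ?case using Suc.IH [OF Suc.prems(1) xE] by simp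
qed

text \<open>$Z_i(H)$ lies in $Z_i(E_n)$ because \<open>H\<close> detects the centres of $E_n$, and
  $Z_i(E_n)$ lies in $Z_i(D)$ because \<open>D\<close> lies in $E_n$; for $i = n$ this gives $H$
  inside $D$ and class at most $n$. Invariance is proved for the envelope of \<open>H\<close>: the
  test sets themselves need not be invariant under the normalizer.\<close>

lemma upper_central_envelope_main:
  assumes H: "subgroup H G" and n: "trivial_iterated_comms G H n" and B: "test_sets H B n"
  defines "D \<equiv> upper_central G (envelope G B n) n"
  shows "subgroup D G" "H \<subseteq> D" "normalizer_normal G D H" "trivial_iterated_comms G D n"
proof -
  let ?E = "envelope G (\<lambda>_. H) n"
  have sE: "subgroup ?E G" by (rule envelope_subgroup)
  have D: "D = upper_central G ?E n" using envelope_test_sets [OF B order_refl] by (simp add: D_def)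
  have Hc: "H \<subseteq> carrier G" using H by (rule subgroup.subset)
  show sD: "subgroup D G" unfolding D by (rule upper_central_subgroup [OF sE])
  have DE: "D \<subseteq> ?E" unfolding D by (rule upper_central_subset [OF sE])
  have "x \<in> upper_central G ?E i" if "i \<le> n" "x \<in> upper_central G H i" for x i
    using that
  proof (induction i arbitrary: x)
    case (Suc i)
    have "x \<in> H" using Suc.prems by simp
    then have "x \<in> ?E" using subset_envelope [OF Hc] by blast
    moreover have "\<forall>h \<in> H. comm G x h \<in> upper_central G ?E i" using Suc by simp
    ultimately show ?case using upper_central_envelope_iff [OF Hc] Suc.prems(1) Suc_le_lessD by blast
  qed simp
  then show "H \<subseteq> D" using n trivial_iterated_comms_iff [OF H] unfolding D by blast
  have "x \<in> upper_central G D i" if "i \<le> n" "x \<in> upper_central G ?E i" for x i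
    using that
  proof (induction i arbitrary: x)
    case (Suc i)
    have "x \<in> D" using Suc.prems upper_central_mono [OF sE Suc.prems(1)] unfolding D by blast
    moreover have "comm G x y \<in> upper_central G D i" if "y \<in> D" for y
    proof -
      have "comm G x y \<in> upper_central G ?E i" using Suc.prems(2) that DE by auto
      then show ?thesis using Suc.IH Suc.prems(1) by simp
    qed
    ultimately show ?case by simp
  qed simp
  then show "trivial_iterated_comms G D n" using trivial_iterated_comms_iff [OF sD] D by blast
  have Dc: "D \<subseteq> carrier G" using sD by (rule subgroup.subset)
  have Nc: "normalizer G H \<subseteq> carrier G" using mem_normalizer_iff [OF Hc] by blast
  have NH: "g \<otimes> x \<otimes> inv g \<in> H" if "g \<in> normalizer G H" "x \<in> H" for g x
    using that mem_normalizer_iff [OF Hc] by blast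
  have NE: "g \<otimes> x \<otimes> inv g \<in> ?E" if "g \<in> normalizer G H" "x \<in> ?E" for g x
    by (rule envelope_invariant [OF Nc inv_mem_normalizer [OF Hc] Hc NH that])
  show "normalizer_normal G D H"
    unfolding normalizer_normal_iff [OF Hc Dc] unfolding D
    using upper_central_invariant [OF sE Nc inv_mem_normalizer [OF Hc] NE] by blast
qed

section \<open>Centralizers of arbitrary sets as centralizers of finite ones\<close>

lemma not_centralizer_subset:
  assumes "\<not> centralizer G B \<subseteq> centralizer G S"
  obtains x where "x \<in> S" "centralizer G (insert x B) \<subset> centralizer G B"
proof -
  obtain y where y: "y \<in> centralizer G B" "y \<notin> centralizer G S" using assms by blast
  then obtain x where "x \<in> S" "y \<otimes> x \<noteq> x \<otimes> y" by (auto simp: centralizer_def)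
  moreover from this have "y \<notin> centralizer G (insert x B)" by (simp add: centralizer_def)
  moreover have "centralizer G (insert x B) \<subseteq> centralizer G B" by (auto simp: centralizer_def)
  ultimately show thesis using y(1) that by blast
qed

lemma chain_condition_finite_subset:
  assumes mc: "chain_condition_centralizers G" and S: "S \<subseteq> carrier G"
  shows "\<exists>B \<subseteq> S. finite B \<and> centralizer G B \<subseteq> centralizer G S"
proof (rule ccontr)
  assume no: "\<not> ?thesis"
  have "\<exists>A. \<forall>n. (A n \<subseteq> S \<and> finite (A n)) \<and> centralizer G (A (Suc n)) \<subset> centralizer G (A n)"
  proof (rule dependent_nat_choice)
    show "\<exists>B. B \<subseteq> S \<and> finite B" by blast
    fix B and n :: nat assume B: "B \<subseteq> S \<and> finite B"
    then have "\<not> centralizer G B \<subseteq> centralizer G S" using no by blast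
    then obtain x where "x \<in> S" "centralizer G (insert x B) \<subset> centralizer G B"
      by (rule not_centralizer_subset)
    then show "\<exists>B'. (B' \<subseteq> S \<and> finite B') \<and> centralizer G B' \<subset> centralizer G B"
      using B by (intro exI [of _ "insert x B"]) auto
  qed
  then obtain A where A: "\<forall>n. (A n \<subseteq> S \<and> finite (A n)) \<and>
      centralizer G (A (Suc n)) \<subset> centralizer G (A n)" ..
  then have "\<forall>n. A n \<subseteq> carrier G" "\<forall>n. centralizer G (A (Suc n)) \<subset> centralizer G (A n)"
    using S by fast+
  then have "\<exists>A. (\<forall>n. A n \<subseteq> carrier G) \<and> (\<forall>n. centralizer G (A (Suc n)) \<subset> centralizer G (A n))"
    by (intro exI [of _ A] conjI)
  then show False using mc unfolding chain_condition_centralizers_def by (rule notE [rotated])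
qed

text \<open>Otherwise elements of \<open>S\<close> could be adjoined one at a time, each strictly
  lowering the centralizer, for \<open>Suc d\<close> steps. Stage \<open>i\<close> has at most
  \<open>i\<close> elements, hence the bound \<open>d\<close>.\<close>

lemma bounded_chain_finite_subset:
  assumes d: "\<And>k. centralizer_chain G k \<Longrightarrow> k \<le> d" and S: "S \<subseteq> carrier G"
  shows "\<exists>B \<subseteq> S. finite B \<and> card B \<le> d \<and> centralizer G B \<subseteq> centralizer G S"
proof (rule ccontr)
  assume no: "\<not> ?thesis"
  \<comment> \<open>A \<open>centralizer_chain\<close> starts at the singleton of
    \<open>\<one>\<close>, the construction at the empty set; adjoining \<open>\<one>\<close>
    throughout reconciles them.\<close>
  have one: "centralizer G (insert \<one> B) = centralizer G B" for B by (auto simp: centralizer_def)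
  have "\<exists>A. A 0 = {} \<and> (\<forall>i \<le> k. A i \<subseteq> S \<and> finite (A i) \<and> card (A i) \<le> i) \<and>
      (\<forall>i < k. centralizer G (A (Suc i)) \<subset> centralizer G (A i))" if "k \<le> Suc d" for k
    using that
  proof (induction k)
    case 0
    show ?case by (intro exI [of _ "\<lambda>_. {}"]) simp
  next
    case (Suc k)
    then obtain A where A: "A 0 = {}" "\<And>i. i \<le> k \<Longrightarrow> A i \<subseteq> S \<and> finite (A i) \<and> card (A i) \<le> i"
      "\<And>i. i < k \<Longrightarrow> centralizer G (A (Suc i)) \<subset> centralizer G (A i)" by auto
    have "\<not> centralizer G (A k) \<subseteq> centralizer G S"
      using no A(2) [of k] Suc.prems by auto
    then obtain x where x: "x \<in> S" "centralizer G (insert x (A k)) \<subset> centralizer G (A k)"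
      by (rule not_centralizer_subset)
    have c: "card (insert x (A k)) \<le> Suc k"
      using A(2) [of k] by (simp add: card_insert_if)
    let ?A = "A(Suc k := insert x (A k))"
    have "?A i \<subseteq> S \<and> finite (?A i) \<and> card (?A i) \<le> i" if "i \<le> Suc k" for i
      using that A(2) x(1) c by (cases "i = Suc k") auto
    moreover have "centralizer G (?A (Suc i)) \<subset> centralizer G (?A i)" if "i < Suc k" for i
      using that A(3) x(2) by (cases "i = k") auto
    ultimately show ?case using A(1) by (intro exI [of _ ?A]) simp
  qed
  from this [OF order_refl] obtain A where A: "A 0 = {}" "\<And>i. i \<le> Suc d \<Longrightarrow> A i \<subseteq> S"
      "\<And>i. i < Suc d \<Longrightarrow> centralizer G (A (Suc i)) \<subset> centralizer G (A i)" by auto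
  have "centralizer_chain G (Suc d)"
    unfolding centralizer_chain_def
    using A(1,3) subset_trans [OF A(2) S]
    by (intro exI [of _ "\<lambda>i. insert \<one> (A i)"]) (simp add: one)
  then show False using d by fastforce
qed

lemma centralizer_chain_0: "centralizer_chain G 0"
  unfolding centralizer_chain_def by (intro exI [of _ "\<lambda>_. {\<one>}"]) simp

text \<open>Replaces the maximum by two statements on chains, one of existence and one of
  boundedness, which can be passed separately to subgroups.\<close>

lemma has_c_dimension_iff:
  "has_c_dimension G d \<longleftrightarrow> centralizer_chain G d \<and> (\<forall>k. centralizer_chain G k \<longrightarrow> k \<le> d)"
proof
  assume "has_c_dimension G d"
  then obtain b where b: "\<forall>k. centralizer_chain G k \<longrightarrow> k \<le> b" and d: "Max {k. centralizer_chain G k} = d"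
    unfolding has_c_dimension_def finite_c_dimension_def c_dimension_def by blast
  have "{k. centralizer_chain G k} \<subseteq> {..b}" using b by auto
  then have fin: "finite {k. centralizer_chain G k}" by (rule finite_subset) simp
  have "{k. centralizer_chain G k} \<noteq> {}" using centralizer_chain_0 by blast
  then show "centralizer_chain G d \<and> (\<forall>k. centralizer_chain G k \<longrightarrow> k \<le> d)"
    using Max_in [OF fin] Max_ge [OF fin] d by auto
next
  assume *: "centralizer_chain G d \<and> (\<forall>k. centralizer_chain G k \<longrightarrow> k \<le> d)"
  then have "{k. centralizer_chain G k} \<subseteq> {..d}" by auto
  then have fin: "finite {k. centralizer_chain G k}" by (rule finite_subset) simp
  have "Max {k. centralizer_chain G k} = d" using * by (intro Max_eqI [OF fin]) auto
  then show "has_c_dimension G d"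
    unfolding has_c_dimension_def finite_c_dimension_def c_dimension_def using * by blast
qed

end

section \<open>Formulas for the envelopes\<close>

definition gcomm :: "gterm \<Rightarrow> gterm \<Rightarrow> gterm" where
  "gcomm s t = GMult (GMult (GMult s t) (GInv s)) (GInv t)"

definition gconj :: "gform list \<Rightarrow> gform" where
  "gconj \<phi>s = foldr GAnd \<phi>s (GEq GOne GOne)"

text \<open>A definable set is represented by a function that takes a term \<open>t\<close> and a number \<open>b\<close> to a
  formula expressing membership of \<open>t\<close>, in which only variables from \<open>b\<close> on are bound.\<close>

primrec upper_central_form :: "(gterm \<Rightarrow> nat \<Rightarrow> gform) \<Rightarrow> nat \<Rightarrow> gterm \<Rightarrow> nat \<Rightarrow> gform" where
  "upper_central_form F 0 = (\<lambda>t b. GEq t GOne)"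
| "upper_central_form F (Suc i) = (\<lambda>t b. GAnd (F t b) (GNot (GEx b (GAnd (F (GVar b) (Suc b))
     (GNot (upper_central_form F i (gcomm t (GVar b)) (Suc b)))))))"

text \<open>The parameters come in blocks of \<open>m\<close>, one block per level; level
  \<open>k\<close> tests against blocks 0 to \<open>k\<close>, in accordance with the cumulative
  test sets.\<close>

primrec envelope_form :: "nat \<Rightarrow> nat \<Rightarrow> gterm \<Rightarrow> nat \<Rightarrow> gform" where
  "envelope_form m 0 = (\<lambda>t b. GEq GOne GOne)"
| "envelope_form m (Suc k) = (\<lambda>t b. GAnd (envelope_form m k t b) (GNot (GEx b (GAnd (GAnd
     (envelope_form m k (GVar b) (Suc b))
     (gconj (map (\<lambda>i. upper_central_form (envelope_form m k) k (gcomm (GVar b) (GVar (Suc i))) (Suc b))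
       [0..<m * Suc k])))
     (GNot (upper_central_form (envelope_form m k) k (gcomm (GVar b) t) (Suc b)))))))"

definition hull_form :: "nat \<Rightarrow> nat \<Rightarrow> gform" where
  "hull_form m n = upper_central_form (envelope_form m n) n (GVar 0) (Suc (m * n))"

section \<open>Evaluation and free variables of the formulas\<close>

lemma sat_gconj: "sat G e (gconj \<phi>s) \<longleftrightarrow> (\<forall>\<phi> \<in> set \<phi>s. sat G e \<phi>)"
  unfolding gconj_def by (induction \<phi>s) auto

lemma fvars_gconj: "fvars (gconj \<phi>s) = (\<Union>\<phi> \<in> set \<phi>s. fvars \<phi>)"
  unfolding gconj_def by (induction \<phi>s) auto

lemma teval_gcomm: "teval G e (gcomm s t) = comm G (teval G e s) (teval G e t)"
  by (simp add: gcomm_def comm_def)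

lemma tvars_gcomm: "tvars (gcomm s t) = tvars s \<union> tvars t"
  by (auto simp: gcomm_def)

lemma teval_cong: "(\<And>i. i \<in> tvars t \<Longrightarrow> e i = e' i) \<Longrightarrow> teval G e t = teval G e' t"
  by (induction t) auto

lemma sat_cong: "(\<And>i. i \<in> fvars \<phi> \<Longrightarrow> e i = e' i) \<Longrightarrow> sat G e \<phi> \<longleftrightarrow> sat G e' \<phi>"
proof (induction \<phi> arbitrary: e e')
  case (GEq s t)
  have "teval G e s = teval G e' s" "teval G e t = teval G e' t"
    by (rule teval_cong, rule GEq.prems, simp)+
  then show ?case by simp
next
  case (GNot \<phi>)
  have "sat G e \<phi> \<longleftrightarrow> sat G e' \<phi>" by (rule GNot.IH, rule GNot.prems) simp
  then show ?case by simp
next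
  case (GAnd \<phi> \<psi>)
  have "sat G e \<phi> \<longleftrightarrow> sat G e' \<phi>" by (rule GAnd.IH(1), rule GAnd.prems) simp
  moreover have "sat G e \<psi> \<longleftrightarrow> sat G e' \<psi>" by (rule GAnd.IH(2), rule GAnd.prems) simp
  ultimately show ?case by simp
next
  case (GEx j \<phi>)
  have "sat G (e(j := a)) \<phi> \<longleftrightarrow> sat G (e'(j := a)) \<phi>" for a
    using GEx.prems by (intro GEx.IH) auto
  then show ?case by simp
qed

text \<open>\<open>l\<close> is the total number of parameters, the same for all levels. The
  conditions on \<open>b\<close> keep the bound variables clear of the term and of all parameters,
  so that no capture occurs.\<close>

definition free_bounded :: "nat \<Rightarrow> (gterm \<Rightarrow> nat \<Rightarrow> gform) \<Rightarrow> bool" where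
  "free_bounded l F \<longleftrightarrow>
     (\<forall>t b. tvars t \<subseteq> {..<b} \<longrightarrow> l < b \<longrightarrow> fvars (F t b) \<subseteq> tvars t \<union> {1..l})"

lemma free_boundedD:
  "free_bounded l F \<Longrightarrow> tvars t \<subseteq> {..<b} \<Longrightarrow> l < b \<Longrightarrow> fvars (F t b) \<subseteq> tvars t \<union> {1..l}"
  by (simp add: free_bounded_def)

lemma free_bounded_upper_central_form:
  assumes F: "free_bounded l F"
  shows "free_bounded l (upper_central_form F i)"
proof (induction i)
  case 0
  show ?case by (simp add: free_bounded_def)
next
  case (Suc i)
  show ?case unfolding free_bounded_def
  proof (intro allI impI)
    fix t b assume t: "tvars t \<subseteq> {..<b}" and b: "l < b"
    have tb: "tvars t \<subseteq> {..<Suc b}" using t by force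
    have 1: "fvars (F t b) \<subseteq> tvars t \<union> {1..l}" using free_boundedD [OF F t b] .
    have 2: "fvars (F (GVar b) (Suc b)) \<subseteq> {b} \<union> {1..l}" using free_boundedD [OF F, of "GVar b" "Suc b"] b by simp
    have 3: "fvars (upper_central_form F i (gcomm t (GVar b)) (Suc b)) \<subseteq> tvars t \<union> {b} \<union> {1..l}"
      using free_boundedD [OF Suc, of "gcomm t (GVar b)" "Suc b"] tb b by (auto simp: tvars_gcomm)
    show "fvars (upper_central_form F (Suc i) t b) \<subseteq> tvars t \<union> {1..l}"
      using 1 2 3 by auto
  qed
qed

lemma free_bounded_envelope_form:
  "m * k \<le> l \<Longrightarrow> free_bounded l (envelope_form m k)"
proof (induction k)
  case 0
  show ?case by (simp add: free_bounded_def)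
next
  case (Suc k)
  then have IH: "free_bounded l (envelope_form m k)" by simp
  note U = free_bounded_upper_central_form [OF IH, of k]
  show ?case unfolding free_bounded_def
  proof (intro allI impI)
    fix t b assume t: "tvars t \<subseteq> {..<b}" and b: "l < b"
    have tb: "tvars t \<subseteq> {..<Suc b}" using t by force
    have 1: "fvars (envelope_form m k t b) \<subseteq> tvars t \<union> {1..l}" using free_boundedD [OF IH t b] .
    have 2: "fvars (envelope_form m k (GVar b) (Suc b)) \<subseteq> {b} \<union> {1..l}"
      using free_boundedD [OF IH, of "GVar b" "Suc b"] b by simp
    have 3: "fvars (upper_central_form (envelope_form m k) k (gcomm (GVar b) t) (Suc b)) \<subseteq> tvars t \<union> {b} \<union> {1..l}"
      using free_boundedD [OF U, of "gcomm (GVar b) t" "Suc b"] tb b by (auto simp: tvars_gcomm)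
    have 4: "fvars (upper_central_form (envelope_form m k) k (gcomm (GVar b) (GVar (Suc i))) (Suc b)) \<subseteq> {b} \<union> {1..l}"
      if "i < m * Suc k" for i
    proof -
      have i: "Suc i \<le> l" using that Suc.prems by simp
      then show ?thesis
        using free_boundedD [OF U, of "gcomm (GVar b) (GVar (Suc i))" "Suc b"] b by (auto simp: tvars_gcomm)
    qed
    have 5: "fvars (gconj (map (\<lambda>i. upper_central_form (envelope_form m k) k (gcomm (GVar b) (GVar (Suc i))) (Suc b))
       [0..<m * Suc k])) \<subseteq> {b} \<union> {1..l}"
      unfolding fvars_gconj using 4 by fastforce
    show "fvars (envelope_form m (Suc k) t b) \<subseteq> tvars t \<union> {1..l}"
      unfolding envelope_form.simps fvars.simps using 1 2 3 5 by blast
  qed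
qed

lemma formula_in_hull_form: "formula_in (m * n) (hull_form m n)"
proof -
  have "free_bounded (m * n) (upper_central_form (envelope_form m n) n)"
    by (intro free_bounded_upper_central_form free_bounded_envelope_form) simp
  from free_boundedD [OF this, of "GVar 0" "Suc (m * n)"] show ?thesis
    unfolding formula_in_def hull_form_def by auto
qed

text \<open>The semantic counterpart of \<open>free_bounded\<close>: under the conditions on
  \<open>b\<close>, updating variable \<open>b\<close> changes neither the value of \<open>t\<close>
  nor the parameters, so the claim can be applied under the quantifiers.\<close>

definition expresses :: "('a, 'b) monoid_scheme \<Rightarrow> 'a list \<Rightarrow> (gterm \<Rightarrow> nat \<Rightarrow> gform) \<Rightarrow> 'a set \<Rightarrow> bool" where
  "expresses G as F S \<longleftrightarrow> (\<forall>e t b. (\<forall>i. e i \<in> carrier G) \<longrightarrow> (\<forall>i < length as. e (Suc i) = as ! i) \<longrightarrow>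
     tvars t \<subseteq> {..<b} \<longrightarrow> length as < b \<longrightarrow> (sat G e (F t b) \<longleftrightarrow> teval G e t \<in> S))"

lemma expressesD:
  "expresses G as F S \<Longrightarrow> (\<And>i. e i \<in> carrier G) \<Longrightarrow> (\<And>i. i < length as \<Longrightarrow> e (Suc i) = as ! i) \<Longrightarrow>
     tvars t \<subseteq> {..<b} \<Longrightarrow> length as < b \<Longrightarrow> sat G e (F t b) \<longleftrightarrow> teval G e t \<in> S"
  unfolding expresses_def by blast

context group
begin

section \<open>The formulas define the envelopes and their centres\<close>

lemma teval_closed: "(\<And>i. e i \<in> carrier G) \<Longrightarrow> teval G e t \<in> carrier G"
  by (induction t) auto

lemma expresses_upper_central:
  assumes F: "expresses G as F E" and E: "E \<subseteq> carrier G"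
  shows "expresses G as (upper_central_form F i) (upper_central G E i)"
proof (induction i)
  case 0
  show ?case by (simp add: expresses_def)
next
  case (Suc i)
  show ?case unfolding expresses_def
  proof (intro allI impI)
    fix e :: "nat \<Rightarrow> 'a" and t b
    assume e: "\<forall>i. e i \<in> carrier G" and as: "\<forall>i < length as. e (Suc i) = as ! i"
      and t: "tvars t \<subseteq> {..<b}" and b: "length as < b"
    have 1: "sat G e (F t b) \<longleftrightarrow> teval G e t \<in> E"
      using e as t b by (intro expressesD [OF F]) auto
    have t_upd: "teval G (e(b := y)) t = teval G e t" for y
      using t by (intro teval_cong) auto
    have 2: "sat G (e(b := y)) (F (GVar b) (Suc b)) \<longleftrightarrow> y \<in> E" if "y \<in> carrier G" for y
      using e as b that by (subst expressesD [OF F]) auto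
    have 3: "sat G (e(b := y)) (upper_central_form F i (gcomm t (GVar b)) (Suc b)) \<longleftrightarrow>
        comm G (teval G e t) y \<in> upper_central G E i" if "y \<in> carrier G" for y
      using e as b t that by (subst expressesD [OF Suc]) (auto simp: teval_gcomm tvars_gcomm t_upd)
    show "sat G e (upper_central_form F (Suc i) t b) \<longleftrightarrow> teval G e t \<in> upper_central G E (Suc i)"
      using 1 2 3 E by auto
  qed
qed

lemma expresses_envelope:
  assumes as: "set as \<subseteq> carrier G"
  shows "m * k \<le> length as \<Longrightarrow>
    expresses G as (envelope_form m k) (envelope G (\<lambda>k. {as ! p | p. p < m * Suc k}) k)"
proof (induction k)
  case 0
  show ?case by (auto simp: expresses_def teval_closed)
next
  case (Suc k)
  let ?B = "\<lambda>k. {as ! p | p. p < m * Suc k}"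
  let ?E = "envelope G ?B k"
  have IH: "expresses G as (envelope_form m k) ?E" using Suc by simp
  have E: "?E \<subseteq> carrier G" using envelope_subgroup by (rule subgroup.subset)
  note U = expresses_upper_central [OF IH E, of k]
  show ?case unfolding expresses_def
  proof (intro allI impI)
    fix e :: "nat \<Rightarrow> 'a" and t b
    assume e: "\<forall>i. e i \<in> carrier G" and as: "\<forall>i < length as. e (Suc i) = as ! i"
      and t: "tvars t \<subseteq> {..<b}" and b: "length as < b"
    have 1: "sat G e (envelope_form m k t b) \<longleftrightarrow> teval G e t \<in> ?E"
      using e as t b by (intro expressesD [OF IH]) auto
    have t_upd: "teval G (e(b := y)) t = teval G e t" for y
      using t by (intro teval_cong) auto
    have 2: "sat G (e(b := y)) (envelope_form m k (GVar b) (Suc b)) \<longleftrightarrow> y \<in> ?E" if "y \<in> carrier G" for y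
      using e as b that by (subst expressesD [OF IH]) auto
    have 3: "sat G (e(b := y)) (upper_central_form (envelope_form m k) k (gcomm (GVar b) t) (Suc b)) \<longleftrightarrow>
        comm G y (teval G e t) \<in> upper_central G ?E k" if "y \<in> carrier G" for y
      using e as b t that by (subst expressesD [OF U]) (auto simp: teval_gcomm tvars_gcomm t_upd)
    have 4: "sat G (e(b := y)) (upper_central_form (envelope_form m k) k (gcomm (GVar b) (GVar (Suc i))) (Suc b)) \<longleftrightarrow>
        comm G y (as ! i) \<in> upper_central G ?E k" if "y \<in> carrier G" "i < m * Suc k" for y i
    proof -
      have i: "i < length as" using that Suc.prems by simp
      then have ib: "Suc i < b" using b by simp
      then have "(e(b := y)) (Suc i) = as ! i" using as i by simp
      then show ?thesis
        using e as b that ib by (subst expressesD [OF U]) (auto simp: teval_gcomm tvars_gcomm)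
    qed
    have 5: "sat G (e(b := y)) (gconj (map (\<lambda>i. upper_central_form (envelope_form m k) k
        (gcomm (GVar b) (GVar (Suc i))) (Suc b)) [0..<m * Suc k])) \<longleftrightarrow>
        (\<forall>a \<in> ?B k. comm G y a \<in> upper_central G ?E k)" if "y \<in> carrier G" for y
    proof -
      have "sat G (e(b := y)) (gconj (map (\<lambda>i. upper_central_form (envelope_form m k) k
          (gcomm (GVar b) (GVar (Suc i))) (Suc b)) [0..<m * Suc k])) \<longleftrightarrow>
          (\<forall>i < m * Suc k. comm G y (as ! i) \<in> upper_central G ?E k)"
        unfolding sat_gconj using 4 [OF that] by (auto simp del: mult_Suc_right)
      also have "\<dots> \<longleftrightarrow> (\<forall>a \<in> ?B k. comm G y a \<in> upper_central G ?E k)" by blast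
      finally show ?thesis .
    qed
    have "sat G e (envelope_form m (Suc k) t b) \<longleftrightarrow> teval G e t \<in> ?E \<and>
        \<not> (\<exists>y \<in> carrier G. (y \<in> ?E \<and> (\<forall>a \<in> ?B k. comm G y a \<in> upper_central G ?E k)) \<and>
          \<not> comm G y (teval G e t) \<in> upper_central G ?E k)"
      by (simp only: envelope_form.simps sat.simps 1 2 3 5 cong: bex_cong)
    also have "\<dots> \<longleftrightarrow> teval G e t \<in> envelope G ?B (Suc k)"
      unfolding envelope.simps using E by blast
    finally show "sat G e (envelope_form m (Suc k) t b) \<longleftrightarrow> teval G e t \<in> envelope G ?B (Suc k)" .
  qed
qed

lemma solution_set_hull_form:
  assumes as: "set as \<subseteq> carrier G" and l: "length as = m * n"
  shows "solution_set G (hull_form m n) as =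
    upper_central G (envelope G (\<lambda>k. {as ! p | p. p < m * Suc k}) n) n"
proof -
  let ?E = "envelope G (\<lambda>k. {as ! p | p. p < m * Suc k}) n"
  have sE: "subgroup ?E G" by (rule envelope_subgroup)
  have E: "?E \<subseteq> carrier G" using sE by (rule subgroup.subset)
  have ex: "expresses G as (upper_central_form (envelope_form m n) n) (upper_central G ?E n)"
    using expresses_envelope [OF as, of m n] l by (intro expresses_upper_central E) simp
  have "sat G (assignment G (g # as)) (hull_form m n) \<longleftrightarrow> g \<in> upper_central G ?E n"
    if "g \<in> carrier G" for g
    unfolding hull_form_def using as l that
    by (subst expressesD [OF ex]) (auto simp: assignment_def nth_Cons' subset_iff)
  then show ?thesis
    unfolding solution_set_def using subgroup.subset [OF upper_central_subgroup [OF sE, of n]] by blast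
qed

section \<open>Packing the test sets into one list of parameters\<close>

lemma test_sets_mono:
  assumes A: "test_sets H A n" and B: "\<And>k. k < n \<Longrightarrow> A k \<subseteq> B k \<and> B k \<subseteq> H"
  shows "test_sets H B n"
  unfolding test_sets_def
proof (intro allI impI conjI ballI)
  fix k x h
  assume k: "k < n"
  then show "B k \<subseteq> H" using B by blast
  assume x: "x \<in> envelope G (\<lambda>_. H) k" and h: "h \<in> H"
    and b: "\<forall>b \<in> B k. comm G x b \<in> upper_central G (envelope G (\<lambda>_. H) k) k"
  then have "\<forall>a \<in> A k. comm G x a \<in> upper_central G (envelope G (\<lambda>_. H) k) k" using B [OF k] by blast
  then show "comm G x h \<in> upper_central G (envelope G (\<lambda>_. H) k) k"
    using test_setsD(2) [OF A k x] h by blast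
qed

lemma test_sets_list:
  assumes H: "subgroup H G"
    and A: "\<And>k. k < n \<Longrightarrow> finite (A k) \<and> card (A k) \<le> m \<and> A k \<subseteq> H"
    and t: "test_sets H (\<lambda>k. \<Union>j \<le> k. A j) n"
  shows "\<exists>as. length as = m * n \<and> set as \<subseteq> H \<and> test_sets H (\<lambda>k. {as ! p | p. p < m * Suc k}) n"
proof -
  have "\<exists>f. A k \<subseteq> f ` {..<m} \<and> f ` {..<m} \<subseteq> H" if "k < n" for k
  proof -
    note k = that
    obtain g where g: "bij_betw g {0..<card (A k)} (A k)"
      using ex_bij_betw_nat_finite A [OF k] by blast
    have gi: "g ` {0..<card (A k)} = A k" using g by (rule bij_betw_imp_surj_on)
    \<comment> \<open>Sets with fewer than \<open>m\<close> elements are padded with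
      \<open>\<one>\<close>, which lies in \<open>H\<close>, so that each block has length exactly
      \<open>m\<close>.\<close>
    let ?f = "\<lambda>i. if i < card (A k) then g i else \<one>"
    have "A k \<subseteq> ?f ` {..<m}"
    proof
      fix a assume "a \<in> A k"
      then have "a \<in> g ` {0..<card (A k)}" by (simp only: gi)
      then obtain i where "i < card (A k)" "a = g i" by auto
      then show "a \<in> ?f ` {..<m}" using A [OF k] by (intro image_eqI [of _ _ i]) auto
    qed
    moreover have "?f ` {..<m} \<subseteq> H"
      using gi A [OF k] subgroup.one_closed [OF H] by auto
    ultimately show ?thesis by blast
  qed
  then have "\<forall>k. \<exists>f. k < n \<longrightarrow> A k \<subseteq> f ` {..<m} \<and> f ` {..<m} \<subseteq> H" by blast
  from choice [OF this] obtain f where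
    f: "\<And>k. k < n \<Longrightarrow> A k \<subseteq> f k ` {..<m} \<and> f k ` {..<m} \<subseteq> H" by blast
  \<comment> \<open>Block \<open>k\<close> occupies positions \<open>m * k\<close> to
    \<open>m * k + m - 1\<close>; the first \<open>m * Suc k\<close> entries are thus the blocks up
    to \<open>k\<close>.\<close>
  define as where "as = map (\<lambda>p. f (p div m) (p mod m)) [0..<m * n]"
  have asH: "as ! p \<in> H" if "p < m * n" for p
  proof -
    have m: "m > 0" using that by (cases m) auto
    then have "p div m < n" using that by (simp add: less_mult_imp_div_less mult.commute)
    then have "f (p div m) ` {..<m} \<subseteq> H" using f by blast
    then show ?thesis using m that by (auto simp: as_def)
  qed
  have l: "length as = m * n" by (simp add: as_def)
  have "test_sets H (\<lambda>k. {as ! p | p. p < m * Suc k}) n"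
  proof (rule test_sets_mono [OF t], intro conjI)
    fix k assume k: "k < n"
    have mk: "m * Suc k \<le> m * n" using k by (intro mult_le_mono) auto
    then show "{as ! p | p. p < m * Suc k} \<subseteq> H" using asH by fastforce
    show "(\<Union>j \<le> k. A j) \<subseteq> {as ! p | p. p < m * Suc k}"
    proof
      fix a assume "a \<in> (\<Union>j \<le> k. A j)"
      then obtain j where j: "j \<le> k" "a \<in> A j" by blast
      then have "a \<in> f j ` {..<m}" using f [of j] k by auto
      then obtain q where q: "q < m" "a = f j q" by blast
      have "m * j + q < m * Suc j" using q by simp
      also have "\<dots> \<le> m * Suc k" using j by (intro mult_le_mono) auto
      finally have p: "m * j + q < m * Suc k" .
      then have "as ! (m * j + q) = a" using q mk by (simp add: as_def)
      then show "a \<in> {as ! p | p. p < m * Suc k}" using p by blast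
    qed
  qed
  moreover have "set as \<subseteq> H" using asH l by (auto simp: in_set_conv_nth)
  ultimately show ?thesis using l by blast
qed

end

lemma exists_definable_hull:
  fixes G :: "('a, 'b) monoid_scheme"
  assumes "group G" "chain_condition_centralizers G" and H: "subgroup H G"
    and nil: "nilpotent (G\<lparr>carrier := H\<rparr>)"
  shows "\<exists>D. subgroup D G \<and> definable G D \<and> H \<subseteq> D \<and> normalizer_normal G D H \<and>
    nilpotent (G\<lparr>carrier := D\<rparr>) \<and>
    nilpotence_class (G\<lparr>carrier := D\<rparr>) = nilpotence_class (G\<lparr>carrier := H\<rparr>)"
proof -
  interpret group G by fact
  obtain n where "nilpotent_of_class (G\<lparr>carrier := H\<rparr>) n"
    using nil by (simp add: nilpotent_of_class_def)
  then have n: "trivial_iterated_comms G H n" and less: "\<And>m. m < n \<Longrightarrow> \<not> trivial_iterated_comms G H m"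
    and cH: "nilpotence_class (G\<lparr>carrier := H\<rparr>) = n"
    using nilpotent_of_class_iff [OF H] by (auto simp: nilpotent_of_class_def)
  have K: "\<exists>B \<subseteq> S. finite B \<and> card B \<in> UNIV \<and> centralizer G B \<subseteq> centralizer G S" if "S \<subseteq> carrier G" for S
    using chain_condition_finite_subset [OF assms(2) that] by simp
  have "\<exists>A. (\<forall>k < n. finite (A k) \<and> card (A k) \<in> UNIV \<and> A k \<subseteq> H) \<and> test_sets H (\<lambda>k. \<Union>j \<le> k. A j) n"
    by (rule finite_test_sets [OF H K]) auto
  then obtain A where A: "\<forall>k < n. finite (A k) \<and> card (A k) \<in> UNIV \<and> A k \<subseteq> H"
    and t: "test_sets H (\<lambda>k. \<Union>j \<le> k. A j) n" by (elim exE conjE)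
  \<comment> \<open>All blocks must have the same length; the sum serves as a common bound on the
    cardinalities.\<close>
  define m where "m = (\<Sum>k < n. card (A k))"
  have "card (A k) \<le> m" if "k < n" for k
    unfolding m_def using that by (intro member_le_sum) auto
  then have "\<exists>as. length as = m * n \<and> set as \<subseteq> H \<and> test_sets H (\<lambda>k. {as ! p | p. p < m * Suc k}) n"
    using A by (intro test_sets_list [OF H _ t]) blast
  then obtain as where as: "length as = m * n" "set as \<subseteq> H"
    "test_sets H (\<lambda>k. {as ! p | p. p < m * Suc k}) n" by (elim exE conjE)
  have asc: "set as \<subseteq> carrier G" using as(2) subgroup.subset [OF H] by blast
  define D where "D = solution_set G (hull_form m n) as"
  note main = upper_central_envelope_main [OF H n as(3), folded solution_set_hull_form [OF asc as(1)] D_def]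
  have "definable G D"
    unfolding definable_def D_def using asc formula_in_hull_form [of m n] as(1) by metis
  \<comment> \<open>A smaller class of \<open>D\<close> would be inherited by
    \<open>H\<close>.\<close>
  moreover have "nilpotent_of_class (G\<lparr>carrier := D\<rparr>) n"
    unfolding nilpotent_of_class_iff [OF main(1)] using main(2,4) less trivial_iterated_comms_mono by blast
  ultimately show ?thesis
    using main(1-3) by (intro exI [of _ D]) (simp add: nilpotent_of_class_def cH)
qed

lemma envelope_formula_hull_form: "envelope_formula TYPE('a) d n (hull_form d n)"
  unfolding envelope_formula_def
proof (intro conjI allI impI)
  show "formula_in (d * n) (hull_form d n)" by (rule formula_in_hull_form)
  fix G :: "'a monoid" and H
  assume *: "group G \<and> has_c_dimension G d \<and> subgroup H G \<and> nilpotent_of_class (G\<lparr>carrier := H\<rparr>) n"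
  then interpret group G by blast
  have H: "subgroup H G" using * by blast
  have n: "trivial_iterated_comms G H n" and less: "\<And>m. m < n \<Longrightarrow> \<not> trivial_iterated_comms G H m"
    using * nilpotent_of_class_iff [OF H] by auto
  have d: "\<And>k. centralizer_chain G k \<Longrightarrow> k \<le> d" using * has_c_dimension_iff by blast
  have K: "\<exists>B \<subseteq> S. finite B \<and> card B \<in> {..d} \<and> centralizer G B \<subseteq> centralizer G S" if "S \<subseteq> carrier G" for S
    using bounded_chain_finite_subset [OF d that] by simp
  have "\<exists>A. (\<forall>k < n. finite (A k) \<and> card (A k) \<in> {..d} \<and> A k \<subseteq> H) \<and> test_sets H (\<lambda>k. \<Union>j \<le> k. A j) n"
    by (rule finite_test_sets [OF H K]) auto
  then obtain A where A: "\<forall>k < n. finite (A k) \<and> card (A k) \<in> {..d} \<and> A k \<subseteq> H"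
    and t: "test_sets H (\<lambda>k. \<Union>j \<le> k. A j) n" by (elim exE conjE)
  have "\<exists>as. length as = d * n \<and> set as \<subseteq> H \<and> test_sets H (\<lambda>k. {as ! p | p. p < d * Suc k}) n"
    using A by (intro test_sets_list [OF H _ t]) simp
  then obtain as where as: "length as = d * n" "set as \<subseteq> H"
    "test_sets H (\<lambda>k. {as ! p | p. p < d * Suc k}) n" by (elim exE conjE)
  have asc: "set as \<subseteq> carrier G" using as(2) subgroup.subset [OF H] by blast
  define D where "D = solution_set G (hull_form d n) as"
  note main = upper_central_envelope_main [OF H n as(3), folded solution_set_hull_form [OF asc as(1)] D_def]
  have "nilpotent_of_class (G\<lparr>carrier := D\<rparr>) n"
    unfolding nilpotent_of_class_iff [OF main(1)] using main(2,4) less trivial_iterated_comms_mono by blast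
  then show "\<exists>as. length as = d * n \<and> set as \<subseteq> carrier G \<and>
      subgroup (solution_set G (hull_form d n) as) G \<and>
      nilpotent_of_class (G\<lparr>carrier := solution_set G (hull_form d n) as\<rparr>) n \<and>
      H \<subseteq> solution_set G (hull_form d n) as \<and>
      normalizer_normal G (solution_set G (hull_form d n) as) H"
    using main(1-3) as(1) asc unfolding D_def by (intro exI [of _ as]) simp
qed

section \<open>Reduction to countable groups\<close>

instance gterm :: countable by countable_datatype

instance gform :: countable by countable_datatype

section \<open>Skolem hulls for arbitrary relations\<close>

lemma finite_tvars: "finite (tvars t)"
  by (induction t) auto

lemma finite_fvars: "finite (fvars \<phi>)"
  by (induction \<phi>) (auto simp: finite_tvars)

text \<open>\<open>l\<close> holds parameters and \<open>w\<close> a tuple of witnesses; lists put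
  relations of all arities into one family. Closure under an operation is the case where
  \<open>l\<close> determines \<open>w\<close>.\<close>

definition reflects :: "'a set \<Rightarrow> 'a set \<Rightarrow> ('a list \<Rightarrow> 'a list \<Rightarrow> bool) \<Rightarrow> bool" where
  "reflects U C P \<longleftrightarrow> (\<forall>l \<in> lists C. \<forall>w \<in> lists U. P l w \<longrightarrow> (\<exists>w \<in> lists C. P l w))"

lemma reflectsE:
  assumes "reflects U C P" "l \<in> lists C" "w \<in> lists U" "P l w"
  obtains w' where "w' \<in> lists C" "P l w'"
  using assms unfolding reflects_def by blast

text \<open>A Skolem closure: chosen witnesses for all parameter lists are added, and this is
  iterated. A list, being finite, appears at some finite stage, and the next stage contains its
  witnesses.\<close>

lemma countable_reflecting_subset:
  fixes U :: "'a set" and \<P> :: "('a list \<Rightarrow> 'a list \<Rightarrow> bool) set"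
  assumes "countable \<P>"
  obtains C where "countable C" "C \<subseteq> U" "\<And>P. P \<in> \<P> \<Longrightarrow> reflects U C P"
proof -
  define wit where "wit P l = (if \<exists>w. w \<in> lists U \<and> P l w then SOME w. w \<in> lists U \<and> P l w else [])"
    for P :: "'a list \<Rightarrow> 'a list \<Rightarrow> bool" and l
  have witU: "wit P l \<in> lists U" for P l
    unfolding wit_def using someI_ex [of "\<lambda>w. w \<in> lists U \<and> P l w"] by auto
  have wit: "P l (wit P l)" if "w \<in> lists U" "P l w" for P l w
    unfolding wit_def using someI_ex [of "\<lambda>w. w \<in> lists U \<and> P l w"] that by auto
  define step where "step X = X \<union> (\<Union>P \<in> \<P>. \<Union>l \<in> lists X. set (wit P l))" for X
  \<comment> \<open>The empty start suffices: the empty list is available as parameter and brings in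
    the first elements.\<close>
  define X where "X k = (step ^^ k) {}" for k
  have X_Suc: "X (Suc k) = step (X k)" for k by (simp add: X_def)
  have XU: "X k \<subseteq> U" for k
  proof (induction k)
    case (Suc k)
    have "set (wit P l) \<subseteq> U" for P l using witU [of P l] by auto
    then show ?case using Suc unfolding X_Suc step_def by blast
  qed (simp add: X_def)
  have countX: "countable (X k)" for k
  proof (induction k)
    case (Suc k)
    then show ?case unfolding X_Suc step_def using assms
      by (intro countable_Un countable_UN countable_lists) (auto intro: countable_finite)
  qed (simp add: X_def)
  have mono: "X i \<subseteq> X j" if "i \<le> j" for i j
    by (rule lift_Suc_mono_le [OF _ that]) (auto simp: X_Suc step_def)
  have lists_X: "\<exists>k. l \<in> lists (X k)" if "l \<in> lists (\<Union>k. X k)" for l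
    using that
  proof (induction l)
    case (Cons x l)
    then obtain i j where ij: "x \<in> X i" "l \<in> lists (X j)" by auto
    have "X i \<subseteq> X (max i j)" "X j \<subseteq> X (max i j)" by (simp_all add: mono)
    then have "x \<in> X (max i j)" "l \<in> lists (X (max i j))" using ij lists_mono by blast+
    then have "x # l \<in> lists (X (max i j))" by simp
    then show ?case by blast
  qed simp
  have "reflects U (\<Union>k. X k) P" if P: "P \<in> \<P>" for P
    unfolding reflects_def
  proof (intro ballI impI)
    fix l w assume "l \<in> lists (\<Union>k. X k)" and w: "w \<in> lists U" "P l w"
    then obtain k where k: "l \<in> lists (X k)" using lists_X by blast
    have "set (wit P l) \<subseteq> X (Suc k)" unfolding X_Suc step_def using P k by blast
    then have "wit P l \<in> lists (\<Union>k. X k)" by auto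
    then show "\<exists>w \<in> lists (\<Union>k. X k). P l w" using wit [of w P l] w by blast
  qed
  then show thesis using that [of "\<Union>k. X k"] countX XU by blast
qed

text \<open>The list \<open>w\<close> consists of \<open>x\<^sub>0, \<dots>, x\<^sub>k\<^sub>-\<^sub>1, y\<^sub>0, \<dots>, y\<^sub>k\<^sub>-\<^sub>1\<close>, where \<open>y\<^sub>i\<close> centralizes
  \<open>x\<^sub>j\<close> for all \<open>j < i\<close> but not \<open>x\<^sub>i\<close>.\<close>

definition chain_witness :: "('a, 'b) monoid_scheme \<Rightarrow> nat \<Rightarrow> 'a list \<Rightarrow> bool" where
  "chain_witness G k w \<longleftrightarrow> length w = 2 * k \<and>
     (\<forall>i < k. w ! (k + i) \<otimes>\<^bsub>G\<^esub> w ! i \<noteq> w ! i \<otimes>\<^bsub>G\<^esub> w ! (k + i) \<and>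
       (\<forall>j < i. w ! (k + i) \<otimes>\<^bsub>G\<^esub> w ! j = w ! j \<otimes>\<^bsub>G\<^esub> w ! (k + i)))"

text \<open>Strictness of each inclusion is witnessed by some $x_i$ in the larger set and $y_i$
  centralizing the smaller one. A chain thus becomes a finite pattern of commuting and non-commuting
  elements, which embeddings preserve and reflect.\<close>

lemma (in group) centralizer_chain_iff_witness:
  "centralizer_chain G k \<longleftrightarrow> (\<exists>w \<in> lists (carrier G). chain_witness G k w)"
proof
  assume "centralizer_chain G k"
  then obtain A where A: "\<forall>i \<le> k. A i \<subseteq> carrier G"
    "\<forall>i < k. centralizer G (A (Suc i)) \<subset> centralizer G (A i)"
    unfolding centralizer_chain_def by blast
  have "\<exists>x y. x \<in> A (Suc i) \<and> y \<in> centralizer G (A i) \<and> y \<otimes> x \<noteq> x \<otimes> y" if "i < k" for i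
  proof -
    have "centralizer G (A (Suc i)) \<subset> centralizer G (A i)" using A(2) that by blast
    then obtain y where "y \<in> centralizer G (A i)" "y \<notin> centralizer G (A (Suc i))" by blast
    then show ?thesis by (auto simp: centralizer_def)
  qed
  then have "\<forall>i. \<exists>x y. i < k \<longrightarrow> x \<in> A (Suc i) \<and> y \<in> centralizer G (A i) \<and> y \<otimes> x \<noteq> x \<otimes> y" by blast
  from choice [OF this] obtain x where
    "\<forall>i. \<exists>y. i < k \<longrightarrow> x i \<in> A (Suc i) \<and> y \<in> centralizer G (A i) \<and> y \<otimes> x i \<noteq> x i \<otimes> y" ..
  from choice [OF this] obtain y where
    xy: "\<And>i. i < k \<Longrightarrow> x i \<in> A (Suc i) \<and> y i \<in> centralizer G (A i) \<and> y i \<otimes> x i \<noteq> x i \<otimes> y i" by blast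
  have comm: "y i \<otimes> x j = x j \<otimes> y i" if "j < i" "i < k" for i j
  proof -
    have "centralizer G (A i) \<subseteq> centralizer G (A (Suc j))"
      using that A(2)
    proof (induction i rule: less_induct)
      case (less i)
      show ?case
      proof (cases "i = Suc j")
        case False
        then obtain i' where i': "i = Suc i'" "j < i'" using less.prems(1) by (cases i) auto
        then have "centralizer G (A i') \<subseteq> centralizer G (A (Suc j))"
          using less.prems A(2) by (intro less.IH) auto
        moreover have "centralizer G (A (Suc i')) \<subset> centralizer G (A i')"
          using less.prems i' by simp
        ultimately show ?thesis unfolding i'(1) by blast
      qed simp
    qed
    then show ?thesis using xy [of i] xy [of j] that by (auto simp: centralizer_def)
  qed
  let ?w = "map x [0..<k] @ map y [0..<k]"
  have "x i \<in> carrier G \<and> y i \<in> carrier G" if "i < k" for i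
    using xy [OF that] A(1) [rule_format, of "Suc i"] that by (auto simp: centralizer_def)
  then have "?w \<in> lists (carrier G)" by auto
  moreover have "chain_witness G k ?w"
    unfolding chain_witness_def using xy comm by (simp add: nth_append)
  ultimately show "\<exists>w \<in> lists (carrier G). chain_witness G k w" by blast
next
  assume "\<exists>w \<in> lists (carrier G). chain_witness G k w"
  then obtain w where w: "w \<in> lists (carrier G)" "length w = 2 * k"
    and ne: "\<And>i. i < k \<Longrightarrow> w ! (k + i) \<otimes> w ! i \<noteq> w ! i \<otimes> w ! (k + i)"
    and eq: "\<And>i j. i < k \<Longrightarrow> j < i \<Longrightarrow> w ! (k + i) \<otimes> w ! j = w ! j \<otimes> w ! (k + i)"
    unfolding chain_witness_def by blast
  have wc: "w ! i \<in> carrier G" if "i < 2 * k" for i using w that by (auto simp: in_lists_conv_set)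
  define A where "A i = insert \<one> ((!) w ` {..<i})" for i
  have "A 0 = {\<one>}" by (simp add: A_def)
  moreover have "\<forall>i \<le> k. A i \<subseteq> carrier G" using wc by (auto simp: A_def)
  moreover have "centralizer G (A (Suc i)) \<subset> centralizer G (A i)" if "i < k" for i
  proof -
    have "w ! (k + i) \<in> centralizer G (A i)" using wc that eq by (auto simp: A_def centralizer_def)
    moreover have "w ! (k + i) \<notin> centralizer G (A (Suc i))"
      using ne [OF that] by (auto simp: A_def centralizer_def)
    moreover have "centralizer G (A (Suc i)) \<subseteq> centralizer G (A i)"
      by (auto simp: A_def centralizer_def)
    ultimately show ?thesis by blast
  qed
  ultimately show "centralizer_chain G k" unfolding centralizer_chain_def by (intro exI [of _ A]) simp
qed

text \<open>The hypothesis on the formula concerns groups with elements of type \<open>nat\<close>,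
  so the countable subgroup is recoded; \<open>g\<close> decodes.\<close>

lemma (in group) countable_subgroup_nat_copy:
  assumes C: "subgroup C G" "countable C"
  obtains G' :: "nat monoid" and g where "group G'" "g \<in> hom G' G" "inj_on g (carrier G')" "g ` carrier G' = C"
proof -
  define f where "f = to_nat_on C"
  have f: "inj_on f C" unfolding f_def using C(2) by (rule inj_on_to_nat_on)
  define g where "g = inv_into C f"
  define G' :: "nat monoid" where
    "G' = \<lparr>carrier = f ` C, mult = \<lambda>x y. f (g x \<otimes> g y), one = f \<one>\<rparr>"
  have gf: "g (f c) = c" if "c \<in> C" for c using f that by (simp add: g_def)
  note cl = subgroup.m_closed [OF C(1)] subgroup.one_closed [OF C(1)] subgroup.m_inv_closed [OF C(1)]
  note mem = subgroup.mem_carrier [OF C(1)]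
  have "group G'"
  proof (rule groupI)
    show "\<exists>y \<in> carrier G'. y \<otimes>\<^bsub>G'\<^esub> x = \<one>\<^bsub>G'\<^esub>" if "x \<in> carrier G'" for x
    proof -
      from that obtain c where c: "c \<in> C" "x = f c" by (auto simp: G'_def)
      then show ?thesis by (intro bexI [of _ "f (inv c)"]) (auto simp: G'_def gf cl mem)
    qed
  qed (auto simp: G'_def gf cl mem m_assoc)
  moreover have "g \<in> hom G' G" by (rule homI) (auto simp: G'_def gf cl mem)
  moreover have "inj_on g (carrier G')" by (rule inj_onI) (auto simp: G'_def gf)
  moreover have "g ` carrier G' = C" by (force simp: G'_def gf)
  ultimately show thesis by (rule that)
qed

section \<open>Embeddings of groups and the properties they reflect\<close>

locale group_embedding = group_hom G' G g
  for G' :: "('c, 'd) monoid_scheme" and G :: "('a, 'b) monoid_scheme" and g +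
  assumes inj: "inj_on g (carrier G')"
begin

lemma embed_eq_iff [simp]: "x \<in> carrier G' \<Longrightarrow> y \<in> carrier G' \<Longrightarrow> g x = g y \<longleftrightarrow> x = y"
  using inj by (rule inj_on_eq_iff)

lemma embed_comm: "x \<in> carrier G' \<Longrightarrow> y \<in> carrier G' \<Longrightarrow> g (comm G' x y) = comm G (g x) (g y)"
  by (simp add: comm_def)

lemma embed_foldl_comm:
  "x \<in> carrier G' \<Longrightarrow> ys \<in> lists (carrier G') \<Longrightarrow>
    g (foldl (comm G') x ys) = foldl (comm G) (g x) (map g ys) \<and> foldl (comm G') x ys \<in> carrier G'"
  by (induction ys arbitrary: x) (simp_all add: embed_comm)

lemma lists_image_carrier:
  assumes "w \<in> lists (g ` carrier G')"
  obtains w' where "w' \<in> lists (carrier G')" "w = map g w'"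
  using assms unfolding lists_image by blast

lemma embed_teval:
  "(\<And>i. e i \<in> carrier G') \<Longrightarrow> g (teval G' e t) = teval G (g \<circ> e) t"
  by (induction t) (simp_all add: H.teval_closed G.teval_closed)

text \<open>The Tarski--Vaught test: \<open>el\<close> provides a witness in the image for each
  existential statement with parameters there, which settles the quantifier case.\<close>

lemma embed_sat:
  assumes el: "\<And>\<phi> j e a. (\<And>i. e i \<in> g ` carrier G') \<Longrightarrow> a \<in> carrier G \<Longrightarrow> sat G (e(j := a)) \<phi> \<Longrightarrow>
      \<exists>a \<in> g ` carrier G'. sat G (e(j := a)) \<phi>"
    and e: "\<And>i. e i \<in> carrier G'"
  shows "sat G' e \<phi> \<longleftrightarrow> sat G (g \<circ> e) \<phi>"
  using e
proof (induction \<phi> arbitrary: e)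
  case (GEq s t)
  show ?case
    unfolding sat.simps embed_teval [of e, OF GEq.prems, symmetric]
    using G.teval_closed [of e, OF GEq.prems] by simp
next
  case (GEx j \<phi>)
  have upd: "(g \<circ> e)(j := g a) = g \<circ> e(j := a)" for a by auto
  have "sat G' (e(j := a)) \<phi> \<longleftrightarrow> sat G ((g \<circ> e)(j := g a)) \<phi>" if "a \<in> carrier G'" for a
    unfolding upd using GEx.prems that by (intro GEx.IH) simp
  moreover have "(\<exists>a \<in> carrier G. sat G ((g \<circ> e)(j := a)) \<phi>) \<longleftrightarrow>
      (\<exists>a \<in> carrier G'. sat G ((g \<circ> e)(j := g a)) \<phi>)"
    using el [of "g \<circ> e" _ j \<phi>] GEx.prems by (auto intro: hom_closed)
  ultimately show ?case by (simp only: sat.simps cong: bex_cong)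
qed auto

lemma preimage_subgroup:
  assumes "subgroup H G"
  shows "subgroup {x \<in> carrier G'. g x \<in> H} G'"
  using assms by unfold_locales (auto simp: subgroup.m_closed subgroup.m_inv_closed subgroup.one_closed)

lemma preimage_trivial_iterated_comms:
  assumes "trivial_iterated_comms G H n"
  shows "trivial_iterated_comms G' {x \<in> carrier G'. g x \<in> H} n"
  unfolding trivial_iterated_comms_def
proof (intro ballI impI)
  fix x ys assume x: "x \<in> {x \<in> carrier G'. g x \<in> H}" and ys: "ys \<in> lists {x \<in> carrier G'. g x \<in> H}"
    and l: "length ys = n"
  have ys': "ys \<in> lists (carrier G')" "map g ys \<in> lists H" using ys by auto
  have "g (foldl (comm G') x ys) = \<one>\<^bsub>G\<^esub>"
    using assms x ys' l embed_foldl_comm [of x ys] by (simp add: trivial_iterated_comms_def)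
  then have "g (foldl (comm G') x ys) = g \<one>\<^bsub>G'\<^esub>" by simp
  then show "foldl (comm G') x ys = \<one>\<^bsub>G'\<^esub>"
    using embed_foldl_comm [of x ys] x ys' by (subst (asm) embed_eq_iff) auto
qed

lemma preimage_normalizer:
  assumes H: "H \<subseteq> carrier G" and x: "x \<in> carrier G'" "g x \<in> normalizer G H"
  shows "x \<in> normalizer G' {x \<in> carrier G'. g x \<in> H}"
proof -
  have N: "h \<otimes>\<^bsub>G\<^esub> y \<otimes>\<^bsub>G\<^esub> inv\<^bsub>G\<^esub> h \<in> H" if "h \<in> normalizer G H" "y \<in> H" for h y
    using that H.mem_normalizer_iff [OF H] by blast
  let ?H = "{x \<in> carrier G'. g x \<in> H}"
  have sub: "y \<in> (\<lambda>h. x \<otimes>\<^bsub>G'\<^esub> h \<otimes>\<^bsub>G'\<^esub> inv\<^bsub>G'\<^esub> x) ` ?H" if y: "y \<in> ?H" for y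
  proof
    show "y = x \<otimes>\<^bsub>G'\<^esub> (inv\<^bsub>G'\<^esub> x \<otimes>\<^bsub>G'\<^esub> y \<otimes>\<^bsub>G'\<^esub> x) \<otimes>\<^bsub>G'\<^esub> inv\<^bsub>G'\<^esub> x"
      using x y by (simp add: G.word_simps)
    have "inv\<^bsub>G\<^esub> g x \<otimes>\<^bsub>G\<^esub> g y \<otimes>\<^bsub>G\<^esub> inv\<^bsub>G\<^esub> (inv\<^bsub>G\<^esub> g x) \<in> H"
      using N H.inv_mem_normalizer [OF H x(2)] y by blast
    then show "inv\<^bsub>G'\<^esub> x \<otimes>\<^bsub>G'\<^esub> y \<otimes>\<^bsub>G'\<^esub> x \<in> ?H" using x y by simp
  qed
  have "(\<lambda>h. x \<otimes>\<^bsub>G'\<^esub> h \<otimes>\<^bsub>G'\<^esub> inv\<^bsub>G'\<^esub> x) ` ?H \<subseteq> ?H" using N [OF x(2)] x by auto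
  then have "(\<lambda>h. x \<otimes>\<^bsub>G'\<^esub> h \<otimes>\<^bsub>G'\<^esub> inv\<^bsub>G'\<^esub> x) ` ?H = ?H" using sub by blast
  then show ?thesis using x G.mem_normalizer_iff [of ?H x] by auto
qed

lemma chain_witness_map:
  assumes "w \<in> lists (carrier G')"
  shows "chain_witness G k (map g w) \<longleftrightarrow> chain_witness G' k w"
proof -
  have w: "w ! i \<in> carrier G'" if "i < length w" for i using assms that by auto
  have eq: "g (w ! i) \<otimes>\<^bsub>G\<^esub> g (w ! j) = g (w ! j) \<otimes>\<^bsub>G\<^esub> g (w ! i) \<longleftrightarrow>
      w ! i \<otimes>\<^bsub>G'\<^esub> w ! j = w ! j \<otimes>\<^bsub>G'\<^esub> w ! i" if "i < length w" "j < length w" for i j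
    using w [OF that(1)] w [OF that(2)] by (simp flip: hom_mult)
  show ?thesis
  proof (cases "length w = 2 * k")
    case True
    then show ?thesis unfolding chain_witness_def using eq by simp
  qed (simp add: chain_witness_def)
qed

end

text \<open>A countable subgroup that contains a counterexample to each property of the solution sets,
  whenever there is one, inherits the failure of the formula.\<close>

lemma envelope_formula_transfer:
  assumes nat: "envelope_formula TYPE(nat) d n \<phi>"
  shows "envelope_formula TYPE('a) d n \<phi>"
  unfolding envelope_formula_def
proof (intro conjI allI impI)
  show "formula_in (d * n) \<phi>" using nat by (simp add: envelope_formula_def)
  fix G :: "'a monoid" and H
  assume *: "group G \<and> has_c_dimension G d \<and> subgroup H G \<and> nilpotent_of_class (G\<lparr>carrier := H\<rparr>) n"
  then interpret G: group G by blast
  have H: "subgroup H G" using * by blast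
  have Hc: "H \<subseteq> carrier G" using H by (rule subgroup.subset)
  have Hn: "trivial_iterated_comms G H n" and Hless: "\<And>m. m < n \<Longrightarrow> \<not> trivial_iterated_comms G H m"
    using * G.nilpotent_of_class_iff [OF H] by auto
  have dG: "centralizer_chain G d" "\<And>k. centralizer_chain G k \<Longrightarrow> k \<le> d"
    using * G.has_c_dimension_iff by blast+
  define D where "D = solution_set G \<phi>"
  \<comment> \<open>The \<open>P\<close> predicates carry the hypotheses to the subgroup:
    \<open>P_sat\<close> makes it elementary, \<open>P_chain\<close> keeps the dimension from
    dropping, \<open>P_class\<close> the nilpotence class.\<close>
  define P_sat :: "gform \<times> nat \<Rightarrow> 'a list \<Rightarrow> 'a list \<Rightarrow> bool" where
    "P_sat = (\<lambda>(\<psi>, j) l w. length w = 1 \<and> sat G ((assignment G l)(j := hd w)) \<psi>)"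
  define P_one :: "'a list \<Rightarrow> 'a list \<Rightarrow> bool" where "P_one = (\<lambda>l w. w = [\<one>\<^bsub>G\<^esub>])"
  define P_mult :: "'a list \<Rightarrow> 'a list \<Rightarrow> bool" where "P_mult = (\<lambda>l w. w = [l ! 0 \<otimes>\<^bsub>G\<^esub> l ! 1])"
  define P_inv :: "'a list \<Rightarrow> 'a list \<Rightarrow> bool" where "P_inv = (\<lambda>l w. w = [inv\<^bsub>G\<^esub> (l ! 0)])"
  define P_chain :: "'a list \<Rightarrow> 'a list \<Rightarrow> bool" where "P_chain = (\<lambda>l w. chain_witness G d w)"
  define P_class where
    "P_class = (\<lambda>m (l :: 'a list) w. length w = Suc m \<and> set w \<subseteq> H \<and> foldl (comm G) (hd w) (tl w) \<noteq> \<one>\<^bsub>G\<^esub>)"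
  \<comment> \<open>The \<open>Q\<close> predicates describe the ways in which \<open>D l\<close>
    can fail. Since \<open>H\<close> and its normalizer need not be definable, elementarity alone
    would not reflect these failures.\<close>
  define Q_super :: "'a list \<Rightarrow> 'a list \<Rightarrow> bool" where
    "Q_super = (\<lambda>l w. length w = 1 \<and> w ! 0 \<in> H \<and> w ! 0 \<notin> D l)"
  define Q_mult :: "'a list \<Rightarrow> 'a list \<Rightarrow> bool" where
    "Q_mult = (\<lambda>l w. length w = 2 \<and> w ! 0 \<in> D l \<and> w ! 1 \<in> D l \<and> w ! 0 \<otimes>\<^bsub>G\<^esub> w ! 1 \<notin> D l)"
  define Q_inv :: "'a list \<Rightarrow> 'a list \<Rightarrow> bool" where
    "Q_inv = (\<lambda>l w. length w = 1 \<and> w ! 0 \<in> D l \<and> inv\<^bsub>G\<^esub> (w ! 0) \<notin> D l)"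
  define Q_class :: "'a list \<Rightarrow> 'a list \<Rightarrow> bool" where
    "Q_class = (\<lambda>l w. length w = Suc n \<and> set w \<subseteq> D l \<and> foldl (comm G) (hd w) (tl w) \<noteq> \<one>\<^bsub>G\<^esub>)"
  define Q_norm :: "'a list \<Rightarrow> 'a list \<Rightarrow> bool" where
    "Q_norm = (\<lambda>l w. length w = 2 \<and> w ! 0 \<in> normalizer G H \<and> w ! 1 \<in> D l \<and>
      w ! 0 \<otimes>\<^bsub>G\<^esub> w ! 1 \<otimes>\<^bsub>G\<^esub> inv\<^bsub>G\<^esub> (w ! 0) \<notin> D l)"
  obtain C where C: "countable C" "C \<subseteq> carrier G"
    and rC: "\<And>P. P \<in> range P_sat \<union> range P_class \<union>
      {P_one, P_mult, P_inv, P_chain, Q_super, Q_mult, Q_inv, Q_class, Q_norm} \<Longrightarrow> reflects (carrier G) C P"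
    by (rule countable_reflecting_subset
        [of "range P_sat \<union> range P_class \<union>
          {P_one, P_mult, P_inv, P_chain, Q_super, Q_mult, Q_inv, Q_class, Q_norm}" "carrier G"]) auto
  have r: "reflects (carrier G) C (P_sat p)" "reflects (carrier G) C (P_class m)"
    "reflects (carrier G) C P_one" "reflects (carrier G) C P_mult" "reflects (carrier G) C P_inv"
    "reflects (carrier G) C P_chain" "reflects (carrier G) C Q_super" "reflects (carrier G) C Q_mult"
    "reflects (carrier G) C Q_inv" "reflects (carrier G) C Q_class" "reflects (carrier G) C Q_norm" for p m
    by (rule rC, simp)+
  have "subgroup C G"
  proof
    show "C \<subseteq> carrier G" by fact
    show "\<one>\<^bsub>G\<^esub> \<in> C"
      using reflectsE [OF r(3), of "[]" "[\<one>\<^bsub>G\<^esub>]"] by (auto simp: P_one_def)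
    show "x \<otimes>\<^bsub>G\<^esub> y \<in> C" if "x \<in> C" "y \<in> C" for x y
      using reflectsE [OF r(4), of "[x, y]" "[x \<otimes>\<^bsub>G\<^esub> y]"] that C by (auto simp: P_mult_def)
    show "inv\<^bsub>G\<^esub> x \<in> C" if "x \<in> C" for x
      using reflectsE [OF r(5), of "[x]" "[inv\<^bsub>G\<^esub> x]"] that C by (auto simp: P_inv_def)
  qed
  then obtain G' :: "nat monoid" and g where G': "Group.group G'" "g \<in> hom G' G" "inj_on g (carrier G')"
    and gC: "g ` carrier G' = C"
    using G.countable_subgroup_nat_copy C(1) by blast
  interpret G': group G' by fact
  interpret group_embedding G' G g
    by unfold_locales (use G' in auto)
  have lift: "\<exists>w'. w' \<in> lists (carrier G') \<and> P (map g l) (map g w')"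
    if P: "reflects (carrier G) C P" and l: "l \<in> lists (carrier G')"
      and w: "w \<in> lists (carrier G)" "P (map g l) w" for P l w
  proof -
    have "map g l \<in> lists C" using l gC by auto
    then obtain w1 where "w1 \<in> lists (g ` carrier G')" "P (map g l) w1"
      using reflectsE [OF P _ w] gC by blast
    then show ?thesis using lists_image_carrier by blast
  qed
  have el: "\<exists>a \<in> g ` carrier G'. sat G (e(j := a)) \<psi>"
    if e: "\<And>i. e i \<in> g ` carrier G'" and a: "a \<in> carrier G" "sat G (e(j := a)) \<psi>" for \<psi> j e a
  proof -
    \<comment> \<open>Only finitely many values of \<open>e\<close> matter to the formula, so they
      can be passed as a list over \<open>C\<close>.\<close>
    obtain N where N: "fvars \<psi> \<subseteq> {..<N}"
      using finite_fvars [of \<psi>] finite_nat_iff_bounded by blast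
    have eq: "sat G ((assignment G (map e [0..<N]))(j := b)) \<psi> \<longleftrightarrow> sat G (e(j := b)) \<psi>" for b
      using N by (intro sat_cong) (auto simp: assignment_def)
    have "map e [0..<N] \<in> lists C" using e gC by auto
    moreover have "P_sat (\<psi>, j) (map e [0..<N]) [a]" using a(2) eq by (simp add: P_sat_def)
    ultimately obtain w where w: "w \<in> lists C" "P_sat (\<psi>, j) (map e [0..<N]) w"
      using reflectsE [OF r(1), of "map e [0..<N]" "[a]"] a(1) by auto
    then obtain b where "w = [b]" by (auto simp: P_sat_def length_Suc_conv)
    then show ?thesis using w eq gC by (auto simp: P_sat_def)
  qed
  have sat_iff: "sat G' e \<psi> \<longleftrightarrow> sat G (g \<circ> e) \<psi>" if "\<And>i. e i \<in> carrier G'" for e \<psi>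
    by (rule embed_sat [OF el that])
  define H' where "H' = {x \<in> carrier G'. g x \<in> H}"
  have H': "subgroup H' G'" unfolding H'_def by (rule preimage_subgroup [OF H])
  have "\<not> trivial_iterated_comms G' H' m" if m: "m < n" for m
  proof -
    obtain x ys where xy: "x \<in> H" "ys \<in> lists H" "length ys = m" "foldl (comm G) x ys \<noteq> \<one>\<^bsub>G\<^esub>"
      using Hless [OF m] unfolding trivial_iterated_comms_def by blast
    then have "P_class m (map g []) (x # ys)" by (auto simp: P_class_def)
    moreover have "x # ys \<in> lists (carrier G)" using xy Hc by auto
    ultimately obtain w where w: "w \<in> lists (carrier G')" "P_class m (map g []) (map g w)"
      using lift [OF r(2), of "[]" "x # ys" m] by auto
    then obtain x' ys' where e: "w = x' # ys'" by (cases w) (auto simp: P_class_def)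
    have c: "x' \<in> carrier G'" "ys' \<in> lists (carrier G')" using w(1) e by auto
    have "foldl (comm G) (g x') (map g ys') \<noteq> \<one>\<^bsub>G\<^esub>" using w(2) e by (simp add: P_class_def)
    then have "foldl (comm G') x' ys' \<noteq> \<one>\<^bsub>G'\<^esub>" using embed_foldl_comm [OF c] by auto
    moreover have "x' \<in> H'" "ys' \<in> lists H'" "length ys' = m"
      using w(2) e c by (auto simp: P_class_def H'_def)
    ultimately show ?thesis unfolding trivial_iterated_comms_def by blast
  qed
  then have nil': "nilpotent_of_class (G'\<lparr>carrier := H'\<rparr>) n"
    using G'.nilpotent_of_class_iff [OF H'] preimage_trivial_iterated_comms [OF Hn] by (simp add: H'_def)
  have "centralizer_chain G' d"
  proof -
    obtain w where "w \<in> lists (carrier G)" "chain_witness G d w"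
      using dG(1) G.centralizer_chain_iff_witness by blast
    then obtain w' where "w' \<in> lists (carrier G')" "chain_witness G d (map g w')"
      using lift [OF r(6), of "[]" w] by (auto simp: P_chain_def)
    then show ?thesis using chain_witness_map G'.centralizer_chain_iff_witness by blast
  qed
  moreover have "k \<le> d" if k: "centralizer_chain G' k" for k
  proof -
    obtain w where w: "w \<in> lists (carrier G')" "chain_witness G' k w"
      using k G'.centralizer_chain_iff_witness by blast
    then have "map g w \<in> lists (carrier G)" by auto
    then show ?thesis
      using w chain_witness_map dG(2) G.centralizer_chain_iff_witness by blast
  qed
  ultimately have dim': "has_c_dimension G' d" using G'.has_c_dimension_iff by blast
  obtain bs where bs: "length bs = d * n" "set bs \<subseteq> carrier G'"
    and D': "subgroup (solution_set G' \<phi> bs) G'"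
      "nilpotent_of_class (G'\<lparr>carrier := solution_set G' \<phi> bs\<rparr>) n"
      "H' \<subseteq> solution_set G' \<phi> bs"
      "normalizer_normal G' (solution_set G' \<phi> bs) H'"
    using nat dim' nil' H' G'.is_group unfolding envelope_formula_def by blast
  define D' where "D' = solution_set G' \<phi> bs"
  note D' = D' [folded D'_def]
  \<comment> \<open>These parameters become known only after \<open>C\<close> has been fixed. The
    \<open>Q\<close> predicates are reflected for every list over \<open>C\<close>, so any failure
    of \<open>D as\<close> in \<open>G\<close> already occurs in the copy \<open>G'\<close>.\<close>
  define as where "as = map g bs"
  have asl: "length as = d * n" "set as \<subseteq> carrier G" using bs by (auto simp: as_def)
  have bsl: "bs \<in> lists (carrier G')" using bs(2) by auto
  have memD: "g x \<in> D as \<longleftrightarrow> x \<in> D'" if "x \<in> carrier G'" for x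
  proof -
    have "assignment G (g x # as) = g \<circ> assignment G' (x # bs)"
      by (rule ext) (simp add: assignment_def as_def nth_Cons split: nat.split)
    moreover have "assignment G' (x # bs) i \<in> carrier G'" for i
      using that bs(2) by (auto simp: assignment_def nth_Cons split: nat.split)
    ultimately show ?thesis
      using that sat_iff [of "assignment G' (x # bs)" \<phi>] by (simp add: D_def D'_def solution_set_def)
  qed
  have Dc: "D as \<subseteq> carrier G" by (auto simp: D_def solution_set_def)
  have D'c: "D' \<subseteq> carrier G'" by (auto simp: D'_def solution_set_def)
  have HD: "H \<subseteq> D as"
  proof (rule ccontr)
    assume "\<not> H \<subseteq> D as"
    then obtain x where x: "x \<in> H" "x \<notin> D as" by blast
    then have "Q_super (map g bs) [x]" by (simp add: Q_super_def as_def)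
    then obtain w where w: "w \<in> lists (carrier G')" "Q_super (map g bs) (map g w)"
      using lift [OF r(7) bsl, of "[x]"] x Hc by auto
    then obtain y where "w = [y]" by (auto simp: Q_super_def length_Suc_conv)
    then have "y \<in> carrier G'" "g y \<in> H" "g y \<notin> D as" using w by (auto simp: Q_super_def as_def)
    then show False using D'(3) memD by (auto simp: H'_def)
  qed
  have sub: "subgroup (D as) G"
  proof
    show "D as \<subseteq> carrier G" by (rule Dc)
    show "\<one>\<^bsub>G\<^esub> \<in> D as" using HD subgroup.one_closed [OF H] by blast
    show "x \<otimes>\<^bsub>G\<^esub> y \<in> D as" if xy: "x \<in> D as" "y \<in> D as" for x y
    proof (rule ccontr)
      assume "x \<otimes>\<^bsub>G\<^esub> y \<notin> D as"
      then have "Q_mult (map g bs) [x, y]" using that by (simp add: Q_mult_def as_def)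
      then obtain w where w: "w \<in> lists (carrier G')" "Q_mult (map g bs) (map g w)"
        using lift [OF r(8) bsl, of "[x, y]"] xy Dc by auto
      then obtain u v where "w = [u, v]" by (auto simp: Q_mult_def numeral_2_eq_2 length_Suc_conv)
      then have "u \<in> carrier G'" "v \<in> carrier G'" "g u \<in> D as" "g v \<in> D as" "g (u \<otimes>\<^bsub>G'\<^esub> v) \<notin> D as"
        using w by (auto simp: Q_mult_def as_def)
      then show False
        using memD subgroup.m_closed [OF D'(1)] G'.m_closed [of u v] by blast
    qed
    show "inv\<^bsub>G\<^esub> x \<in> D as" if x: "x \<in> D as" for x
    proof (rule ccontr)
      assume "inv\<^bsub>G\<^esub> x \<notin> D as"
      then have "Q_inv (map g bs) [x]" using that by (simp add: Q_inv_def as_def)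
      then obtain w where w: "w \<in> lists (carrier G')" "Q_inv (map g bs) (map g w)"
        using lift [OF r(9) bsl, of "[x]"] x Dc by auto
      then obtain u where "w = [u]" by (auto simp: Q_inv_def length_Suc_conv)
      then have "u \<in> carrier G'" "g u \<in> D as" "g (inv\<^bsub>G'\<^esub> u) \<notin> D as"
        using w by (auto simp: Q_inv_def as_def)
      then show False
        using memD subgroup.m_inv_closed [OF D'(1)] G'.inv_closed [of u] by blast
    qed
  qed
  have "trivial_iterated_comms G (D as) n"
  proof (rule ccontr)
    assume "\<not> trivial_iterated_comms G (D as) n"
    then obtain x ys where xy: "x \<in> D as" "ys \<in> lists (D as)" "length ys = n" "foldl (comm G) x ys \<noteq> \<one>\<^bsub>G\<^esub>"
      unfolding trivial_iterated_comms_def by blast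
    then have "Q_class (map g bs) (x # ys)" by (auto simp: Q_class_def as_def)
    moreover have "x # ys \<in> lists (carrier G)" using xy Dc by auto
    ultimately obtain w where w: "w \<in> lists (carrier G')" "Q_class (map g bs) (map g w)"
      using lift [OF r(10) bsl, of "x # ys"] by auto
    then obtain x' ys' where e: "w = x' # ys'" by (cases w) (auto simp: Q_class_def)
    have c: "x' \<in> carrier G'" "ys' \<in> lists (carrier G')" using w(1) e by auto
    have "foldl (comm G) (g x') (map g ys') \<noteq> \<one>\<^bsub>G\<^esub>" using w(2) e by (simp add: Q_class_def)
    then have "foldl (comm G') x' ys' \<noteq> \<one>\<^bsub>G'\<^esub>" using embed_foldl_comm [OF c] by auto
    moreover have "x' \<in> D'" "ys' \<in> lists D'" "length ys' = n"
      using w(2) e c memD by (auto simp: Q_class_def as_def)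
    moreover have "trivial_iterated_comms G' D' n"
      using D'(2) G'.nilpotent_of_class_iff [OF D'(1)] by blast
    ultimately show False unfolding trivial_iterated_comms_def by blast
  qed
  then have nil: "nilpotent_of_class (G\<lparr>carrier := D as\<rparr>) n"
    using G.nilpotent_of_class_iff [OF sub] Hless HD G.trivial_iterated_comms_mono by blast
  have H'c: "H' \<subseteq> carrier G'" by (auto simp: H'_def)
  have "normalizer_normal G (D as) H"
    unfolding G.normalizer_normal_iff [OF Hc Dc]
  proof (intro ballI, rule ccontr)
    fix h x assume hx: "h \<in> normalizer G H" "x \<in> D as" "h \<otimes>\<^bsub>G\<^esub> x \<otimes>\<^bsub>G\<^esub> inv\<^bsub>G\<^esub> h \<notin> D as"
    then have "Q_norm (map g bs) [h, x]" by (simp add: Q_norm_def as_def)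
    moreover have "h \<in> carrier G" using hx(1) G.mem_normalizer_iff [OF Hc] by blast
    ultimately obtain w where w: "w \<in> lists (carrier G')" "Q_norm (map g bs) (map g w)"
      using lift [OF r(11) bsl, of "[h, x]"] hx(2) Dc by auto
    then obtain u v where "w = [u, v]" by (auto simp: Q_norm_def numeral_2_eq_2 length_Suc_conv)
    then have uv: "u \<in> carrier G'" "v \<in> carrier G'" "g u \<in> normalizer G H" "g v \<in> D as"
      "g (u \<otimes>\<^bsub>G'\<^esub> v \<otimes>\<^bsub>G'\<^esub> inv\<^bsub>G'\<^esub> u) \<notin> D as"
      using w by (auto simp: Q_norm_def as_def)
    have "u \<in> normalizer G' H'" unfolding H'_def by (rule preimage_normalizer [OF Hc uv(1,3)])
    moreover have "v \<in> D'" using memD uv by blast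
    ultimately have "u \<otimes>\<^bsub>G'\<^esub> v \<otimes>\<^bsub>G'\<^esub> inv\<^bsub>G'\<^esub> u \<in> D'"
      using D'(4) G'.normalizer_normal_iff [OF H'c D'c] by blast
    then show False using uv(5) memD D'c by blast
  qed
  then show "\<exists>as. length as = d * n \<and> set as \<subseteq> carrier G \<and>
      subgroup (solution_set G \<phi> as) G \<and>
      nilpotent_of_class (G\<lparr>carrier := solution_set G \<phi> as\<rparr>) n \<and>
      H \<subseteq> solution_set G \<phi> as \<and>
      normalizer_normal G (solution_set G \<phi> as) H"
    using asl sub nil HD unfolding D_def by (intro exI [of _ as]) simp
qed

theorem theorem3p4:
  shows "(\<forall>(G :: 'a monoid) H.
            group G \<and> chain_condition_centralizers G \<and>
            subgroup H G \<and> nilpotent (G\<lparr>carrier := H\<rparr>) \<longrightarrow>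
            (\<exists>D. subgroup D G \<and> definable G D \<and> H \<subseteq> D \<and> normalizer_normal G D H \<and>
               nilpotent (G\<lparr>carrier := D\<rparr>) \<and>
               nilpotence_class (G\<lparr>carrier := D\<rparr>) = nilpotence_class (G\<lparr>carrier := H\<rparr>)))
       \<and> (\<forall>d n :: nat. d > 0 \<and> n > 0 \<longrightarrow>
            (\<exists>\<phi>. envelope_formula TYPE(nat) d n \<phi>) \<and>
            (\<forall>\<phi>. envelope_formula TYPE(nat) d n \<phi> \<longrightarrow> envelope_formula TYPE('a) d n \<phi>))"
proof (intro conjI allI impI)
  show "\<exists>\<phi>. envelope_formula TYPE(nat) d n \<phi>" for d n
    using envelope_formula_hull_form by (rule exI)
  show "envelope_formula TYPE('a) d n \<phi>" if "envelope_formula TYPE(nat) d n \<phi>" for d n \<phi>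
    using that by (rule envelope_formula_transfer)
qed (intro exists_definable_hull; simp)

end
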